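(* Consider the random walk in dynamical random environment described in the context, with all the stated assumptions. Then for $\Pi$-almost every realisation $\xi$ of the environment, under the quenched law $\mathbb{P}_\xi$, $$\frac{1}{\sqrt{t}}\,Y_t \Longrightarrow \mathcal{N}(0,\eta^2)\qquad (t\to\infty),$$ i.e. $t^{-1/2}Y_t$ converges in distribution to $(\eta^2)^{1/2}U$, where $U$ is a standard $n$-dimensional Gaussian vector and $\eta^2$ is the positive semidefinite $n\times n$ matrix with entries $$(\eta^2)_{ij}=\sum_{u\in\mathbb{Z}^n}(u_i-b_i)(u_j-b_j)\,\bar P(u),\qquad 1\le i,j\le n.$$
   Context: Let $\mathbb{S}$ be a finite set and $\pi$ a probability measure on $\mathbb{S}$. The environment is a random field $\xi=\{\xi_t(x): x\in\mathbb{Z}^n, t\in\mathbb{Z}^+\}$ of i.i.d. $\mathbb{S}$-valued random variables with law $\pi$; let $\Pi$ denote the corresponding product law on $\mathbb{S}^{\mathbb{Z}^n\times\mathbb{Z}^+}$. Let $P_0$ be a probability distribution on $\mathbb{Z}^n$ and $c:\mathbb{Z}^n\times\mathbb{S}\to\mathbb{R}$ such that: $0\le P_0(u)+c(u,s)\le 1$ for all $u,s$; $\sum_{u}c(u,s)=0$ for all $s$; $\sum_{s}c(u,s)\pi(s)=0$ for all $u$; $P_0$ and $c$ have bounded range (vanish for $|u|$ large); and there is $b^c\in\mathbb{R}^n$ with $\sum_u u\,c(u,s)=b^c$ for all $s\in\mathbb{S}$. Given $\xi$, $(X_t)_{t\in\mathbb{Z}^+}$ is the Markov chain on $\mathbb{Z}^n$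 (started from a fixed deterministic point) with transition probabilities $\mathbb{P}(X_{t+1}=y\mid X_t=x,\xi)=P_0(y-x)+c(y-x,\xi_t(x))$; $\mathbb{P}_\xi$ denotes this conditional (quenched) law. Let $\bar P(u)=P_0(u)+\sum_{s}\pi(s)c(u,s)$, $b^0=\sum_u uP_0(u)$, $b=b^0+b^c$, and $Y_t=X_t-tb$. *)

theory Defs
  imports "HOL-Probability.Probability"
begin

definition ivec :: "int^'n \<Rightarrow> real^'n" where
  "ivec u = (\<chi> i. of_int (u $ i))"

definition step_pmf :: "(int^'n) pmf \<Rightarrow> (int^'n \<Rightarrow> 's \<Rightarrow> real) \<Rightarrow> 's \<Rightarrow> (int^'n) pmf" where
  "step_pmf P0 c s = embed_pmf (\<lambda>u. pmf P0 u + c u s)"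

fun quenched_law :: "(int^'n) pmf \<Rightarrow> (int^'n \<Rightarrow> 's \<Rightarrow> real) \<Rightarrow> (nat \<times> (int^'n) \<Rightarrow> 's)
    \<Rightarrow> int^'n \<Rightarrow> nat \<Rightarrow> (int^'n) pmf" where
  "quenched_law P0 c xi x0 0 = return_pmf x0"
| "quenched_law P0 c xi x0 (Suc t) =
     bind_pmf (quenched_law P0 c xi x0 t) (\<lambda>x. map_pmf (\<lambda>u. x + u) (step_pmf P0 c (xi (t, x))))"

definition env_law :: "'s pmf \<Rightarrow> (nat \<times> (int^'n) \<Rightarrow> 's) measure" where
  "env_law mu = PiM UNIV (\<lambda>_. measure_pmf mu)"

definition conv_distr :: "(nat \<Rightarrow> 'a::metric_space measure) \<Rightarrow> 'a measure \<Rightarrow> bool" where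
  "conv_distr M L \<longleftrightarrow> (\<forall>f :: 'a \<Rightarrow> real. continuous_on UNIV f \<and> bounded (range f) \<longrightarrow>
      (\<lambda>t. integral\<^sup>L (M t) f) \<longlonglongrightarrow> integral\<^sup>L L f)"

definition std_gaussian :: "(real^'n) measure" where
  "std_gaussian = density lborel
     (\<lambda>x. ennreal ((2 * pi) powr (- real CARD('n) / 2) * exp (- (norm x)\<^sup>2 / 2)))"

definition psd_sqrt :: "real^'n^'n \<Rightarrow> real^'n^'n" where
  "psd_sqrt M = (THE A. transpose A = A \<and> (\<forall>x. 0 \<le> x \<bullet> (A *v x)) \<and> A ** A = M)"

end

theory Submission
  imports Defs
begin

text \<open>
  Since the drift does not depend on the environment, \<open>Y\<close> is a quenched martingale up to its starting
  point, and the conditional covariance of a step depends only on the state of the environment at the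
  current space-time point. The walk never revisits a space-time point, so under the annealed law the
  states it sees are i.i.d. with law \<open>\<mu>\<close>; Hoeffding's inequality and Borel--Cantelli make their
  empirical frequencies converge for almost every environment. For such an environment, multiplying
  \<open>exp (i \<theta> \<bullet> Y / sqrt t)\<close> by the exponential of half the accumulated conditional variance gives a
  process whose mean changes by \<open>o(1/t)\<close> per step, which identifies the limit of the characteristic
  functions.
\<close>

subsection \<open>Weak convergence from characteristic functions\<close>

text \<open>The obstacle is that the claim is quenched, while independence is available only after
  averaging over the environment. The passage works because the quenched probability of a frequency
  deviation is itself a random variable of the environment: its mean is a binomial tail, and
  nonnegative variables with summable means tend to 0 almost surely. Since \<open>'s\<close> is
  finite, the accumulated conditional variance is a linear function of the state counts, so the walk
  is carried along with its counts and nothing else about the path is recorded. The discarded null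
  set depends on countably many thresholds and states, but not on \<open>\<theta>\<close> or on a
  test function; after it is removed, every estimate is made for one fixed environment.

  The limit law enters only through its characteristic function, and \<open>psd_sqrt\<close> only
  through being symmetric with the right square. As \<open>psd_sqrt\<close> is a definite
  description, even these two facts require both existence and uniqueness of the root.\<close>

inductive trig_poly :: "('a::real_inner \<Rightarrow> complex) \<Rightarrow> bool" where
  iexp: "trig_poly (\<lambda>x. iexp (\<theta> \<bullet> x))"
| scale: "trig_poly f \<Longrightarrow> trig_poly (\<lambda>x. a * f x)"
| add: "trig_poly f \<Longrightarrow> trig_poly g \<Longrightarrow> trig_poly (\<lambda>x. f x + g x)"

lemma trig_poly_const: "trig_poly (\<lambda>x. a)"
  using trig_poly.scale[OF trig_poly.iexp[of 0], of a] by simp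

text \<open>Characters multiply by adding frequencies, so the linear span is already an algebra.
  Products are not a constructor because convergence of integrals passes to linear combinations but
  not to products.\<close>

lemma trig_poly_mult:
  assumes "trig_poly f" "trig_poly g"
  shows "trig_poly (\<lambda>x. f x * g x)"
  using assms
proof (induction f rule: trig_poly.induct)
  case (iexp \<theta>)
  from iexp.prems show ?case
  proof (induction g rule: trig_poly.induct)
    case (iexp \<theta>')
    show ?case using trig_poly.iexp[of "\<theta> + \<theta>'"]
      by (simp add: inner_add_left exp_add[symmetric] algebra_simps)
  next
    case (scale f a)
    then show ?case using trig_poly.scale[of _ a] by (simp add: mult.left_commute)
  next
    case (add f g)
    then show ?case using trig_poly.add by (force simp: distrib_left)
  qed
next
  case (scale f a)
  then show ?case using trig_poly.scale[of _ a] by (simp add: mult.assoc)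
next
  case (add f g)
  then show ?case using trig_poly.add by (force simp: distrib_right)
qed

lemma trig_poly_sum:
  assumes "finite I" "\<And>i. i \<in> I \<Longrightarrow> trig_poly (f i)"
  shows "trig_poly (\<lambda>x. \<Sum>i\<in>I. f i x)"
  using assms by (induction I rule: finite_induct) (auto intro: trig_poly_const trig_poly.add)

lemma trig_poly_sin: "trig_poly (\<lambda>x. complex_of_real (sin (\<theta> \<bullet> x)))"
proof -
  have "trig_poly (\<lambda>x. (1 / (2 * \<i>)) * iexp (\<theta> \<bullet> x) + (- 1 / (2 * \<i>)) * iexp ((- \<theta>) \<bullet> x))"
    by (intro trig_poly.intros)
  moreover have "(1 / (2 * \<i>)) * iexp (\<theta> \<bullet> x) + (- 1 / (2 * \<i>)) * iexp ((- \<theta>) \<bullet> x)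
      = complex_of_real (sin (\<theta> \<bullet> x))" for x
    by (simp add: sin_of_real[symmetric] sin_exp_eq field_simps)
  ultimately show ?thesis by simp
qed

lemma trig_poly_real_polynomial_sin:
  fixes p :: "real^'n \<Rightarrow> real"
  assumes "real_polynomial_function p"
  shows "trig_poly (\<lambda>x::real^'n. complex_of_real (p (\<chi> i. sin (x $ i / L))))"
  using assms
proof (induction p rule: real_polynomial_function.induct)
  case (linear f)
  interpret bounded_linear f by fact
  have v: "y = (\<Sum>i\<in>UNIV. (y $ i) *\<^sub>R axis i 1)" for y :: "real^'n"
    by (simp add: vec_eq_iff axis_def if_distrib cong: if_cong)
  have f_eq: "f y = (\<Sum>i\<in>UNIV. (y $ i) * f (axis i 1))" for y
    by (subst v) (simp add: sum scaleR)
  have "complex_of_real (f (\<chi> i. sin (x $ i / L)))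
     = (\<Sum>i\<in>UNIV. complex_of_real (f (axis i 1)) * complex_of_real (sin (axis i (1 / L) \<bullet> x)))" for x :: "real^'n"
    by (subst f_eq) (simp add: inner_axis' mult.commute)
  then show ?case
    by (simp only:) (intro trig_poly_sum trig_poly.scale trig_poly_sin; simp)
qed (auto intro: trig_poly_const trig_poly.add trig_poly_mult)

text \<open>
  The map \<open>x \<mapsto> (sin (x\<^sub>i / L))\<^sub>i\<close> is injective on the box and sends all of space into
  \<open>[-1, 1]\<^sup>n\<close>, so a polynomial approximation of \<open>f\<close> in these coordinates is automatically bounded
  outside the box.
\<close>

lemma trig_poly_approx:
  fixes f :: "real^'n \<Rightarrow> real"
  assumes f: "continuous_on UNIV f" and bd: "\<And>x. \<bar>f x\<bar> \<le> B" and "L > 0" "e > 0"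
  obtains g where "trig_poly (\<lambda>x. complex_of_real (g x))" "\<And>x. \<bar>g x\<bar> \<le> B + e"
    "\<And>x. (\<And>i. \<bar>x $ i\<bar> \<le> L * (pi / 2)) \<Longrightarrow> \<bar>f x - g x\<bar> \<le> e"
proof -
  define S :: "(real^'n) set" where "S = {s. \<forall>i. -1 \<le> s $ i \<and> s $ i \<le> 1}"
  \<comment> \<open>\<open>arcsin\<close> inverts the sine coordinates exactly on the box
    \<open>\<bar>x $ i\<bar> \<le> L * (pi / 2)\<close>, so \<open>F\<close> is \<open>f\<close>
    read in these coordinates; every value of \<open>F\<close> is a value of \<open>f\<close>, hence
    bounded by \<open>B\<close>.\<close>
  define F where "F s = f (\<chi> i. L * arcsin (s $ i))" for s :: "real^'n"
  have S: "S = cbox (\<chi> i. -1) (\<chi> i. 1)"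
    by (auto simp: S_def mem_box_cart)
  then have "compact S" by simp
  moreover have "continuous_on S F"
  proof -
    have "continuous_on S (\<lambda>s. arcsin (s $ i))" for i
      by (rule continuous_on_arcsin) (auto simp: S_def intro!: continuous_on_component)
    then have "continuous_on S (\<lambda>s. \<chi> i. L * arcsin (s $ i))"
      by (intro continuous_on_vec_lambda continuous_on_mult_left)
    from continuous_on_compose2[OF f this] show ?thesis
      by (simp add: F_def[abs_def])
  qed
  ultimately obtain p where p: "real_polynomial_function p" "\<And>s. s \<in> S \<Longrightarrow> \<bar>F s - p s\<bar> < e"
    using Stone_Weierstrass_real_polynomial_function[of S F e] \<open>e > 0\<close> by metis
  define \<sigma> :: "real^'n \<Rightarrow> real^'n" where "\<sigma> x = (\<chi> i. sin (x $ i / L))" for x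
  have \<sigma>: "\<sigma> x \<in> S" for x
    by (auto simp: \<sigma>_def S_def)
  show thesis
  proof (rule that[of "\<lambda>x. p (\<sigma> x)"])
    show "trig_poly (\<lambda>x. complex_of_real (p (\<sigma> x)))"
      unfolding \<sigma>_def by (rule trig_poly_real_polynomial_sin) fact
    show "\<bar>p (\<sigma> x)\<bar> \<le> B + e" for x
      using p(2)[OF \<sigma>[of x]] bd[of "\<chi> i. L * arcsin (\<sigma> x $ i)"] by (simp add: F_def)
    show "\<bar>f x - p (\<sigma> x)\<bar> \<le> e" if x: "\<And>i. \<bar>x $ i\<bar> \<le> L * (pi / 2)" for x
    proof -
      have "arcsin (sin (x $ i / L)) = x $ i / L" for i
        using x[of i] \<open>L > 0\<close> by (intro arcsin_sin) (auto simp: field_simps abs_le_iff)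
      then have "F (\<sigma> x) = f x"
        using \<open>L > 0\<close> by (simp add: F_def \<sigma>_def)
      then show ?thesis using p(2)[OF \<sigma>[of x]] by simp
    qed
  qed
qed

lemma trig_poly_continuous: "trig_poly f \<Longrightarrow> continuous_on UNIV f"
  by (induction f rule: trig_poly.induct) (auto intro!: continuous_intros)

lemma trig_poly_bounded:
  assumes "trig_poly f" shows "\<exists>B. \<forall>x. cmod (f x) \<le> B"
  using assms
proof (induction f rule: trig_poly.induct)
  case (iexp \<theta>)
  then show ?case by (intro exI[of _ 1]) (simp add: norm_exp_i_times)
next
  case (scale f a)
  then show ?case by (metis mult_left_mono norm_ge_zero norm_mult)
next
  case (add f g)
  then show ?case by (meson add_mono norm_triangle_le)
qed

lemma trig_poly_integrable:
  fixes f :: "'a::euclidean_space \<Rightarrow> complex"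
  assumes "trig_poly f" "prob_space M" "sets M = sets borel"
  shows "integrable M f"
proof -
  interpret prob_space M by fact
  obtain B where "\<And>x. cmod (f x) \<le> B" using trig_poly_bounded[OF assms(1)] by auto
  moreover have "f \<in> borel_measurable M"
    using borel_measurable_continuous_onI[OF trig_poly_continuous[OF assms(1)]] assms(3)
    by (simp cong: measurable_cong_sets)
  ultimately show ?thesis by (intro integrable_const_bound[where B = B]) auto
qed

text \<open>By linearity from the characters; boundedness matters in the case \<open>add\<close>,
  where splitting the integral needs integrability.\<close>

lemma trig_poly_integral_tendsto:
  fixes M :: "nat \<Rightarrow> ('a::euclidean_space) measure"
  assumes "trig_poly f"
    and M: "\<And>t. prob_space (M t)" "\<And>t. sets (M t) = sets borel"
    and N: "prob_space N" "sets N = sets borel"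
    and char: "\<And>\<theta>. (\<lambda>t. \<integral>x. iexp (\<theta> \<bullet> x) \<partial>M t) \<longlonglongrightarrow> (\<integral>x. iexp (\<theta> \<bullet> x) \<partial>N)"
  shows "(\<lambda>t. integral\<^sup>L (M t) f) \<longlonglongrightarrow> integral\<^sup>L N f"
  using assms(1)
proof (induction f rule: trig_poly.induct)
  case (iexp \<theta>)
  show ?case by (rule char)
next
  case (scale f a)
  then show ?case by (simp del: mult_cancel_left) (intro tendsto_intros)
next
  case (add f g)
  then show ?case
    using trig_poly_integrable[OF add(1)] trig_poly_integrable[OF add(2)] M N
    by (simp add: tendsto_add)
qed

text \<open>On \<open>K\<close> the integrand is at most \<open>e\<close>, off \<open>K\<close> at
  most \<open>\<bar>f x\<bar> + \<bar>g x\<bar> \<le> 2 * B + e\<close>. The slightly larger bound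
  for \<open>g\<close> is the one that \<open>trig_poly_approx\<close> delivers.\<close>

lemma integral_diff_le_tail:
  fixes f g :: "'a::euclidean_space \<Rightarrow> real"
  assumes M: "prob_space M" "sets M = sets borel"
    and f: "continuous_on UNIV f" "\<And>x. \<bar>f x\<bar> \<le> B"
    and g: "continuous_on UNIV g" "\<And>x. \<bar>g x\<bar> \<le> B + e"
    and K: "K \<in> sets borel" "\<And>x. x \<in> K \<Longrightarrow> \<bar>f x - g x\<bar> \<le> e" and "e \<ge> 0"
  shows "\<bar>integral\<^sup>L M f - integral\<^sup>L M g\<bar> \<le> e + (2 * B + e) * measure M (- K)"
proof -
  interpret prob_space M by fact
  have [measurable]: "f \<in> borel_measurable M" "g \<in> borel_measurable M" "- K \<in> sets M"
    using borel_measurable_continuous_onI[OF f(1)] borel_measurable_continuous_onI[OF g(1)] M(2) K(1)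
    by (simp_all add: Compl_in_sets_lebesgue cong: measurable_cong_sets)
  have If: "integrable M f" by (rule integrable_const_bound[where B=B]) (use f in auto)
  have Ig: "integrable M g" by (rule integrable_const_bound[where B="B+e"]) (use g in auto)
  have "\<bar>integral\<^sup>L M f - integral\<^sup>L M g\<bar> = \<bar>\<integral>x. f x - g x \<partial>M\<bar>"
    using If Ig by simp
  also have "\<dots> \<le> (\<integral>x. \<bar>f x - g x\<bar> \<partial>M)"
    by (rule integral_abs_bound)
  also have "\<dots> \<le> (\<integral>x. e + (2 * B + e) * indicator (- K) x \<partial>M)"
  proof (rule integral_mono)
    show "integrable M (\<lambda>x. \<bar>f x - g x\<bar>)" using If Ig by simp
    show "integrable M (\<lambda>x. e + (2 * B + e) * indicator (- K) x)"
      by (intro Bochner_Integration.integrable_add integrable_mult_right integrable_real_indicator)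
        (auto simp: emeasure_eq_measure)
    show "\<bar>f x - g x\<bar> \<le> e + (2 * B + e) * indicator (- K) x" for x
      using K(2)[of x] f(2)[of x] g(2)[of x] \<open>e \<ge> 0\<close> by (cases "x \<in> K") auto
  qed
  also have "\<dots> = e + (2 * B + e) * measure M (- K)"
    by (subst Bochner_Integration.integral_add)
      (auto simp: emeasure_eq_measure prob_space  intro!: integrable_mult_right integrable_real_indicator)
  finally show ?thesis .
qed

text \<open>The sufficiency half of Levy's continuity theorem, with tightness as a hypothesis.
  Tightness gives one box for all \<open>t\<close>, so a single trigonometric polynomial replaces
  \<open>f\<close> under every \<open>M t\<close> and under \<open>N\<close>.\<close>

lemma conv_distr_of_characteristic_functions:
  fixes M :: "nat \<Rightarrow> (real^'n) measure" and N :: "(real^'n) measure"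
  assumes M: "\<And>t. prob_space (M t)" "\<And>t. sets (M t) = sets borel"
    and N: "prob_space N" "sets N = sets borel"
    and char: "\<And>\<theta>. (\<lambda>t. \<integral>x. iexp (\<theta> \<bullet> x) \<partial>M t) \<longlonglongrightarrow> (\<integral>x. iexp (\<theta> \<bullet> x) \<partial>N)"
    and tight: "\<And>e. e > 0 \<Longrightarrow> \<exists>K. \<forall>t. measure (M t) (- {x. \<forall>i. \<bar>x $ i\<bar> \<le> K}) \<le> e"
  shows "conv_distr M N"
  unfolding conv_distr_def
proof (intro allI impI, elim conjE)
  fix f :: "real^'n \<Rightarrow> real"
  assume f: "continuous_on UNIV f" and "bounded (range f)"
  then obtain B where B: "\<And>x. \<bar>f x\<bar> \<le> B" "B > 0"
    by (force simp: bounded_pos)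
  let ?box = "\<lambda>K. {x::real^'n. \<forall>i. \<bar>x $ i\<bar> \<le> K}"
  have box: "?box K = cbox (\<chi> i. - K) (\<chi> i. K)" for K
    by (auto simp: mem_box_cart abs_le_iff minus_le_iff)
  have box_sets: "?box K \<in> sets borel" for K
    unfolding box by simp
  have box_mono: "?box K \<subseteq> ?box K'" if "K \<le> K'" for K K'
    using that order_trans by blast
  interpret N: prob_space N by (rule N)
  \<comment> \<open>A single probability measure is tight by continuity from above. The bound is
    stated for all larger \<open>K\<close> so that one \<open>K\<close> can serve both
    \<open>N\<close> and the sequence.\<close>
  have tightN: "\<exists>K0. \<forall>K\<ge>K0. measure N (- ?box K) \<le> e" if "e > 0" for e
  proof -
    have "(\<lambda>k. N.prob (- ?box (real k))) \<longlonglongrightarrow> N.prob (\<Inter>k. - ?box (real k))"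
    proof (rule N.finite_Lim_measure_decseq)
      show "range (\<lambda>k. - ?box (real k)) \<subseteq> N.events"
        using borel_comp[OF box_sets] N(2) by blast
      show "decseq (\<lambda>k. - ?box (real k))"
        unfolding decseq_def by (intro allI impI Compl_anti_mono box_mono) simp
    qed
    moreover have "(\<Inter>k. - ?box (real k)) = {}"
    proof -
      have "\<exists>k. \<forall>i. \<bar>x $ i\<bar> \<le> real k" for x :: "real^'n"
        using real_arch_simple[of "norm x"] component_le_norm_cart[of x] by (meson order_trans)
      then show ?thesis by auto
    qed
    ultimately have "(\<lambda>k. N.prob (- ?box (real k))) \<longlonglongrightarrow> 0" by simp
    then have "\<forall>\<^sub>F k in sequentially. N.prob (- ?box (real k)) < e"
      using that by (rule order_tendstoD)
    then obtain k where "N.prob (- ?box (real k)) < e" by (auto simp: eventually_sequentially)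
    moreover have "N.prob (- ?box K) \<le> N.prob (- ?box (real k))" if "K \<ge> real k" for K
      using that borel_comp[OF box_sets] N by (intro N.finite_measure_mono Compl_anti_mono box_mono) auto
    ultimately show ?thesis by (meson less_imp_le order_trans)
  qed
  show "(\<lambda>t. integral\<^sup>L (M t) f) \<longlonglongrightarrow> integral\<^sup>L N f"
  proof (rule LIMSEQ_I)
    fix r :: real assume "r > 0"
    \<comment> \<open>Two truncation errors of \<open>2 * e\<close> and one error below
      \<open>e\<close> from the trigonometric polynomial stay below \<open>6 * e\<close>. The cap 1
      makes \<open>(2 * B + e) * d \<le> e\<close> for \<open>d = e / (2 * B + 1)\<close>.\<close>
    define e where "e = min 1 (r / 6)"
    have e: "e > 0" "e \<le> 1" "6 * e \<le> r" using \<open>r > 0\<close> by (auto simp: e_def)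
    define d where "d = e / (2 * B + 1)"
    have d: "d > 0" using e B(2) by (simp add: d_def)
    have db: "(2 * B + e) * d \<le> e"
      using e B(2) by (simp add: d_def divide_simps mult.commute)
    obtain K1 where K1: "\<And>t. measure (M t) (- ?box K1) \<le> d" using tight[OF d] by auto
    obtain K2 where K2: "\<And>K. K \<ge> K2 \<Longrightarrow> measure N (- ?box K) \<le> d" using tightN[OF d] by auto
    \<comment> \<open>The entry 1 keeps \<open>K\<close> positive, and with it the scale
      \<open>L\<close> for which \<open>L * (pi / 2) = K\<close>.\<close>
    define K where "K = Max {K1, K2, 1}"
    have K: "K \<ge> K1" "K \<ge> K2" "K \<ge> 1" by (auto simp: K_def)
    have KM: "measure (M t) (- ?box K) \<le> d" for t
    proof -
      interpret M: prob_space "M t" by (rule M)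
      have "M.prob (- ?box K) \<le> M.prob (- ?box K1)"
        using K(1) borel_comp[OF box_sets] M by (intro M.finite_measure_mono Compl_anti_mono box_mono) auto
      then show ?thesis using K1[of t] by simp
    qed
    have KN: "measure N (- ?box K) \<le> d" using K2[OF K(2)] .
    define L where "L = K / (pi / 2)"
    have L: "L > 0" "L * (pi / 2) = K" using K(3) by (auto simp: L_def)
    obtain g where g: "trig_poly (\<lambda>x. complex_of_real (g x))" "\<And>x. \<bar>g x\<bar> \<le> B + e"
      "\<And>x. x \<in> ?box K \<Longrightarrow> \<bar>f x - g x\<bar> \<le> e"
      by (rule trig_poly_approx[OF f B(1) L(1) e(1), unfolded L(2)]) blast
    have gc: "continuous_on UNIV g"
      using continuous_on_Re[OF trig_poly_continuous[OF g(1)]] by simp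
    have cM: "\<bar>integral\<^sup>L (M t) f - integral\<^sup>L (M t) g\<bar> \<le> 2 * e" for t
    proof -
      have "\<bar>integral\<^sup>L (M t) f - integral\<^sup>L (M t) g\<bar> \<le> e + (2 * B + e) * measure (M t) (- ?box K)"
        using e by (intro integral_diff_le_tail[OF M f B(1) gc g(2) box_sets g(3)]) auto
      also have "(2 * B + e) * measure (M t) (- ?box K) \<le> (2 * B + e) * d"
        using KM[of t] B(2) e by (intro mult_left_mono) auto
      finally show ?thesis using db by simp
    qed
    have cN: "\<bar>integral\<^sup>L N f - integral\<^sup>L N g\<bar> \<le> 2 * e"
    proof -
      have "\<bar>integral\<^sup>L N f - integral\<^sup>L N g\<bar> \<le> e + (2 * B + e) * measure N (- ?box K)"
        using e by (intro integral_diff_le_tail[OF N f B(1) gc g(2) box_sets g(3)]) auto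
      also have "(2 * B + e) * measure N (- ?box K) \<le> (2 * B + e) * d"
        using KN B(2) e by (intro mult_left_mono) auto
      finally show ?thesis using db by simp
    qed
    have "(\<lambda>t. integral\<^sup>L (M t) g) \<longlonglongrightarrow> integral\<^sup>L N g"
      using trig_poly_integral_tendsto[OF g(1) M N char]
      by (simp add: integral_complex_of_real tendsto_of_real_iff)
    from LIMSEQ_D[OF this e(1)] obtain t0 where
      "\<And>t. t \<ge> t0 \<Longrightarrow> \<bar>integral\<^sup>L (M t) g - integral\<^sup>L N g\<bar> < e" by auto
    then have "norm (integral\<^sup>L (M t) f - integral\<^sup>L N f) < r" if "t \<ge> t0" for t
      using cM[of t] cN e(3) that by (fastforce simp: abs_le_iff abs_less_iff)
    then show "\<exists>t0. \<forall>t\<ge>t0. norm (integral\<^sup>L (M t) f - integral\<^sup>L N f) < r" by blast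
  qed
qed

subsection \<open>Square roots of positive semidefinite matrices\<close>

text \<open>First-order condition at a maximum: divide by \<open>\<epsilon>\<close> and let it tend
  to 0. The limit is replaced by the explicit choice \<open>a / (\<bar>b\<bar> + 1)\<close>.\<close>

lemma quadratic_nonpos_imp_zero:
  fixes a b :: real
  assumes "\<And>\<epsilon>. \<epsilon> > 0 \<Longrightarrow> 2 * \<epsilon> * a \<le> \<epsilon>\<^sup>2 * b"
  shows "a \<le> 0"
proof (rule ccontr)
  assume "\<not> a \<le> 0"
  then have a: "a > 0" by simp
  define \<epsilon> where "\<epsilon> = a / (\<bar>b\<bar> + 1)"
  have "\<epsilon> > 0" using a by (simp add: \<epsilon>_def add_nonneg_pos)
  from assms[OF this] have "2 * a \<le> \<epsilon> * b" using \<open>\<epsilon> > 0\<close> by (simp add: power2_eq_square)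
  also have "\<dots> \<le> \<epsilon> * (\<bar>b\<bar> + 1)" using \<open>\<epsilon> > 0\<close> by (intro mult_left_mono) auto
  also have "\<dots> = a" by (simp add: \<epsilon>_def)
  finally show False using a by simp
qed

text \<open>A maximiser of the Rayleigh quotient on an invariant subspace is an eigenvector.\<close>

lemma symmetric_eigenvector_exists:
  fixes T :: "'a::euclidean_space \<Rightarrow> 'a"
  assumes T: "linear T" "\<And>x y. T x \<bullet> y = x \<bullet> T y"
    and V: "subspace V" "\<And>x. x \<in> V \<Longrightarrow> T x \<in> V" "V \<noteq> {0}"
  obtains v l where "v \<in> V" "norm v = 1" "T v = l *\<^sub>R v"
proof -
  let ?S = "V \<inter> sphere 0 1"
  have "closed V" using V(1) by (rule closed_subspace)
  then have "compact ?S" by (simp add: closed_Int_compact)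
  moreover obtain w where "w \<in> V" "w \<noteq> 0" using V(1,3) subspace_0 by blast
  then have "w /\<^sub>R norm w \<in> ?S" using V(1) by (auto intro: subspace_mul)
  then have "?S \<noteq> {}" by blast
  moreover have "continuous_on ?S (\<lambda>x. x \<bullet> T x)"
    using T(1) by (intro continuous_intros linear_continuous_on) (simp add: linear_conv_bounded_linear)
  ultimately obtain v where v: "v \<in> ?S" "\<And>x. x \<in> ?S \<Longrightarrow> x \<bullet> T x \<le> v \<bullet> T v"
    by (metis continuous_attains_sup)
  define l where "l = v \<bullet> T v"
  have vv: "v \<bullet> v = 1" "v \<in> V" using v(1) by (auto simp: norm_eq_1)
  have q: "x \<bullet> T x \<le> l * (x \<bullet> x)" if "x \<in> V" for x
  proof (cases "x = 0")
    case True
    then show ?thesis by simp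
  next
    case False
    then have "x /\<^sub>R norm x \<in> ?S" using V(1) that by (auto intro: subspace_mul)
    from v(2)[OF this] have "(x \<bullet> T x) / (norm x)\<^sup>2 \<le> l"
      by (simp add: l_def linear_scale[OF T(1)] power2_eq_square field_simps)
    then show ?thesis using False by (simp add: field_simps power2_norm_eq_inner)
  qed
  \<comment> \<open>First variation in the direction \<open>y\<close>: the linear term in
    \<open>\<epsilon>\<close> of \<open>q\<close> at \<open>v + \<epsilon> *\<^sub>R y\<close>
    cannot be positive. Invariance of \<open>V\<close> then allows \<open>y\<close> to be the
    residual itself, whose squared norm is therefore at most 0.\<close>
  have le0: "(T v - l *\<^sub>R v) \<bullet> y \<le> 0" if "y \<in> V" for y
  proof (rule quadratic_nonpos_imp_zero)
    fix \<epsilon> :: real assume "\<epsilon> > 0"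
    have "v + \<epsilon> *\<^sub>R y \<in> V" using V(1) vv that by (simp add: subspace_add subspace_mul)
    from q[OF this] show "2 * \<epsilon> * ((T v - l *\<^sub>R v) \<bullet> y) \<le> \<epsilon>\<^sup>2 * (l * (y \<bullet> y) - y \<bullet> T y)"
      using T(2)[of v y] vv(1)
      by (simp add: linear_add[OF T(1)] linear_scale[OF T(1)] inner_simps inner_commute
          algebra_simps power2_eq_square l_def[symmetric])
  qed
  have "T v - l *\<^sub>R v \<in> V" using V vv by (simp add: subspace_diff subspace_mul)
  from le0[OF this] have "T v - l *\<^sub>R v = 0"
    by (metis inner_eq_zero_iff inner_ge_zero order_antisym)
  then have "T v = l *\<^sub>R v" by simp
  then show thesis using that[of v l] v(1) by simp
qed

text \<open>Induction on the dimension: split off an eigenvector \<open>v\<close>; its orthogonal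
  complement inside \<open>V\<close> is again invariant, since
  \<open>T x \<bullet> v = x \<bullet> T v = 0\<close> by symmetry. The induction is the reason for
  working on invariant subspaces.\<close>

lemma symmetric_eigenbasis_subspace:
  fixes T :: "'a::euclidean_space \<Rightarrow> 'a"
  assumes T: "linear T" "\<And>x y. T x \<bullet> y = x \<bullet> T y"
    and "subspace V" "\<And>x. x \<in> V \<Longrightarrow> T x \<in> V"
  shows "\<exists>E. finite E \<and> E \<subseteq> V \<and> pairwise orthogonal E \<and> (\<forall>v\<in>E. norm v = 1 \<and> (\<exists>l. T v = l *\<^sub>R v))
           \<and> (\<forall>x\<in>V. x = (\<Sum>v\<in>E. (x \<bullet> v) *\<^sub>R v))"
  using assms(3,4)
proof (induction "dim V" arbitrary: V rule: less_induct)
  case less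
  show ?case
  proof (cases "V = {0}")
    case True
    then show ?thesis by (intro exI[of _ "{}"]) auto
  next
    case False
    obtain v l where v: "v \<in> V" "norm v = 1" "T v = l *\<^sub>R v"
      using symmetric_eigenvector_exists[OF T less.prems(1,2) False] by blast
    define W where "W = {x \<in> V. x \<bullet> v = 0}"
    have W: "subspace W" using less.prems(1) unfolding W_def
      by (auto simp: subspace_def inner_simps)
    have TW: "T x \<in> W" if "x \<in> W" for x
      using that less.prems(2) v T(2)[of x v] by (auto simp: W_def)
    have vv: "v \<bullet> v = 1" using v(2) by (simp add: norm_eq_1)
    have "dim W < dim V"
    proof (rule dim_psubset)
      have "W \<subseteq> V" "v \<notin> W" using vv by (auto simp: W_def)
      then show "span W \<subset> span V" using W less.prems(1) v(1) by (auto simp: span_eq_iff[THEN iffD2])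
    qed
    from less.hyps[OF this W TW] obtain E where
      E: "finite E" "E \<subseteq> W" "pairwise orthogonal E"
        "\<And>w. w \<in> E \<Longrightarrow> norm w = 1 \<and> (\<exists>l. T w = l *\<^sub>R w)"
        "\<And>x. x \<in> W \<Longrightarrow> x = (\<Sum>w\<in>E. (x \<bullet> w) *\<^sub>R w)"
      by blast
    have vE: "v \<notin> E" using E(2) vv by (auto simp: W_def)
    have ov: "v \<bullet> w = 0" if "w \<in> E" for w using E(2) that by (auto simp: W_def inner_commute)
    show ?thesis
    proof (intro exI[of _ "insert v E"] conjI ballI)
      show "finite (insert v E)" using E by simp
      show "insert v E \<subseteq> V" using E v by (auto simp: W_def)
      show "pairwise orthogonal (insert v E)"
        using E(3) ov by (auto simp: pairwise_insert orthogonal_def inner_commute)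
    next
      fix w assume "w \<in> insert v E"
      then show "norm w = 1" "\<exists>l. T w = l *\<^sub>R w" using E(4) v by auto
    next
      fix x assume x: "x \<in> V"
      define y where "y = x - (x \<bullet> v) *\<^sub>R v"
      have "y \<in> W" using x v less.prems(1) vv
        by (auto simp: y_def W_def subspace_diff subspace_mul inner_simps)
      from E(5)[OF this] have "y = (\<Sum>w\<in>E. (y \<bullet> w) *\<^sub>R w)" .
      also have "\<dots> = (\<Sum>w\<in>E. (x \<bullet> w) *\<^sub>R w)"
        by (intro sum.cong refl) (simp add: y_def inner_simps ov)
      finally show "x = (\<Sum>w\<in>insert v E. (x \<bullet> w) *\<^sub>R w)"
        using E(1) vE by (simp add: y_def algebra_simps)
    qed
  qed
qed

lemma symmetric_matrix_inner:
  fixes A :: "real^'n^'n"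
  assumes "transpose A = A"
  shows "(A *v x) \<bullet> y = x \<bullet> (A *v y)"
  by (metis assms dot_lmul_matrix inner_commute vector_transpose_matrix)

lemma symmetric_matrix_eigenbasis:
  fixes M :: "real^'n^'n"
  assumes "transpose M = M"
  obtains E l where "finite E" "\<And>v w. v \<in> E \<Longrightarrow> w \<in> E \<Longrightarrow> v \<bullet> w = (if v = w then 1 else 0)"
    "\<And>v. v \<in> E \<Longrightarrow> M *v v = l v *\<^sub>R v" "\<And>x. x = (\<Sum>v\<in>E. (x \<bullet> v) *\<^sub>R v)"
proof -
  have "\<exists>E. finite E \<and> E \<subseteq> UNIV \<and> pairwise orthogonal E
      \<and> (\<forall>v\<in>E. norm v = 1 \<and> (\<exists>l. M *v v = l *\<^sub>R v)) \<and> (\<forall>x\<in>UNIV. x = (\<Sum>v\<in>E. (x \<bullet> v) *\<^sub>R v))"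
    by (rule symmetric_eigenbasis_subspace)
      (auto simp: symmetric_matrix_inner[OF assms] simp del: vector_transpose_matrix transpose_matrix_vector)
  then obtain E where E: "finite E" "pairwise orthogonal E"
    "\<And>v. v \<in> E \<Longrightarrow> norm v = 1 \<and> (\<exists>l. M *v v = l *\<^sub>R v)" "\<And>x. x = (\<Sum>v\<in>E. (x \<bullet> v) *\<^sub>R v)"
    by blast
  from E(3) obtain l where "\<And>v. v \<in> E \<Longrightarrow> M *v v = l v *\<^sub>R v" by metis
  moreover have "v \<bullet> w = (if v = w then 1 else 0)" if "v \<in> E" "w \<in> E" for v w
    using E(2,3) that by (auto simp: norm_eq_1 pairwise_def orthogonal_def)
  ultimately show thesis using that E(1,4) by blast
qed

text \<open>In an orthonormal eigenbasis each eigenvalue is replaced by its square root; positivity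
  of \<open>M\<close> makes the eigenvalues nonnegative, so the roots square back to them.\<close>

lemma psd_sqrt_exists:
  fixes M :: "real^'n^'n"
  assumes sym: "transpose M = M" and psd: "\<And>x. 0 \<le> x \<bullet> (M *v x)"
  shows "\<exists>A. transpose A = A \<and> (\<forall>x. 0 \<le> x \<bullet> (A *v x)) \<and> A ** A = M"
proof -
  obtain E l where E: "finite E" "\<And>v w. v \<in> E \<Longrightarrow> w \<in> E \<Longrightarrow> v \<bullet> w = (if v = w then 1 else 0)"
    "\<And>v. v \<in> E \<Longrightarrow> M *v v = l v *\<^sub>R v" "\<And>x. x = (\<Sum>v\<in>E. (x \<bullet> v) *\<^sub>R v)"
    using symmetric_matrix_eigenbasis[OF sym] by blast
  have l: "l v \<ge> 0" if "v \<in> E" for v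
    using psd[of v] E(2)[OF that that] E(3)[OF that] by simp
  define T where "T x = (\<Sum>v\<in>E. (sqrt (l v) * (x \<bullet> v)) *\<^sub>R v)" for x
  have T: "linear T"
    unfolding T_def by (intro linearI) (simp_all add: inner_simps algebra_simps sum.distrib scaleR_sum_right)
  define A where "A = matrix T"
  have A: "A *v x = T x" for x
    unfolding A_def using T by (simp add: matrix_works)
  have TE: "T v = sqrt (l v) *\<^sub>R v" if "v \<in> E" for v
  proof -
    have "T v = (\<Sum>w\<in>E. if v = w then sqrt (l v) *\<^sub>R v else 0)"
      unfolding T_def by (intro sum.cong refl) (simp add: E(2) that)
    then show ?thesis using E(1) that by simp
  qed
  have symT: "T x \<bullet> y = x \<bullet> T y" for x y
    by (simp add: T_def inner_sum_left inner_sum_right inner_commute mult_ac)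
  have "transpose A = A"
  proof -
    have "(transpose A *v x) \<bullet> y = (A *v x) \<bullet> y" for x y
      by (metis A dot_lmul_matrix symT transpose_matrix_vector)
    then show ?thesis by (metis matrix_eq vector_eq_rdot)
  qed
  moreover have "0 \<le> x \<bullet> (A *v x)" for x
    unfolding A T_def inner_sum_right using l by (intro sum_nonneg) (simp add: mult.assoc)
  moreover have "A ** A = M"
  proof -
    have TT: "T (T v) = M *v v" if "v \<in> E" for v
      using TE[OF that] E(3)[OF that] l[OF that] by (simp add: linear_scale[OF T])
    have "T (T x) = M *v x" for x
    proof -
      have "T (T x) = T (T (\<Sum>v\<in>E. (x \<bullet> v) *\<^sub>R v))" using E(4) by metis
      also have "\<dots> = (\<Sum>v\<in>E. (x \<bullet> v) *\<^sub>R T (T v))"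
        by (simp add: linear_sum[OF T] linear_scale[OF T])
      also have "\<dots> = (\<Sum>v\<in>E. (x \<bullet> v) *\<^sub>R (M *v v))"
        by (simp add: TT)
      also have "\<dots> = M *v (\<Sum>v\<in>E. (x \<bullet> v) *\<^sub>R v)"
        by (simp add: linear_sum[OF matrix_vector_mul_linear] linear_scale[OF matrix_vector_mul_linear])
      finally show ?thesis using E(4) by metis
    qed
    then show ?thesis by (simp add: matrix_eq A flip: matrix_vector_mul_assoc)
  qed
  ultimately show ?thesis by blast
qed

text \<open>It suffices to compare on eigenvectors \<open>v\<close> of \<open>A\<close>, with no
  simultaneous diagonalisation. From \<open>B *v (B *v v) = (l v * l v) *\<^sub>R v\<close> the
  vector \<open>w = B *v v - l v *\<^sub>R v\<close> is mapped by \<open>B\<close> to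
  \<open>(- l v) *\<^sub>R w\<close>, which positivity of \<open>B\<close> allows for
  \<open>l v > 0\<close> only if \<open>w = 0\<close>. For \<open>l v = 0\<close>, the squared norm
  of \<open>B *v v\<close> is \<open>v \<bullet> (B *v (B *v v)) = 0\<close>.\<close>

lemma psd_sqrt_unique:
  fixes A B :: "real^'n^'n"
  assumes A: "transpose A = A" "\<And>x. 0 \<le> x \<bullet> (A *v x)"
    and B: "transpose B = B" "\<And>x. 0 \<le> x \<bullet> (B *v x)"
    and eq: "A ** A = B ** B"
  shows "A = B"
proof -
  obtain E l where E: "finite E" "\<And>v w. v \<in> E \<Longrightarrow> w \<in> E \<Longrightarrow> v \<bullet> w = (if v = w then 1 else 0)"
    "\<And>v. v \<in> E \<Longrightarrow> A *v v = l v *\<^sub>R v" "\<And>x. x = (\<Sum>v\<in>E. (x \<bullet> v) *\<^sub>R v)"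
    using symmetric_matrix_eigenbasis[OF A(1)] by blast
  have BE: "B *v v = A *v v" if v: "v \<in> E" for v
  proof -
    have l: "l v \<ge> 0" using A(2)[of v] E(2)[OF v v] E(3)[OF v] by simp
    have BB: "B *v (B *v v) = (l v * l v) *\<^sub>R v"
      by (metis E(3)[OF v] eq matrix_vector_mul_assoc matrix_vector_mult_scaleR scaleR_scaleR)
    define w where "w = B *v v - l v *\<^sub>R v"
    have "B *v w = (- l v) *\<^sub>R w"
      by (simp add: w_def matrix_vector_mult_diff_distrib matrix_vector_mult_scaleR BB algebra_simps)
    then have wl: "l v * (w \<bullet> w) \<le> 0" using B(2)[of w] by simp
    show ?thesis
    proof (cases "l v = 0")
      case True
      then have "(B *v v) \<bullet> (B *v v) = 0"
        using symmetric_matrix_inner[OF B(1), of v "B *v v"] BB by simp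
      then show ?thesis using True E(3)[OF v] by simp
    next
      case False
      then have "w = 0" using wl l by (metis inner_gt_zero_iff less_le mult_pos_pos not_le)
      then show ?thesis using E(3)[OF v] by (simp add: w_def)
    qed
  qed
  have "A *v x = B *v x" for x
  proof -
    have "A *v x = A *v (\<Sum>v\<in>E. (x \<bullet> v) *\<^sub>R v)" using E(4) by metis
    also have "\<dots> = (\<Sum>v\<in>E. (x \<bullet> v) *\<^sub>R (A *v v))"
      by (simp add: linear_sum[OF matrix_vector_mul_linear] linear_scale[OF matrix_vector_mul_linear])
    also have "\<dots> = (\<Sum>v\<in>E. (x \<bullet> v) *\<^sub>R (B *v v))" by (simp add: BE)
    also have "\<dots> = B *v (\<Sum>v\<in>E. (x \<bullet> v) *\<^sub>R v)"
      by (simp add: linear_sum[OF matrix_vector_mul_linear] linear_scale[OF matrix_vector_mul_linear])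
    finally show ?thesis using E(4) by metis
  qed
  then show ?thesis by (simp add: matrix_eq)
qed

lemma psd_sqrt_properties:
  fixes M :: "real^'n^'n"
  assumes "transpose M = M" "\<And>x. 0 \<le> x \<bullet> (M *v x)"
  shows "transpose (psd_sqrt M) = psd_sqrt M" "psd_sqrt M ** psd_sqrt M = M"
proof -
  have "\<exists>!A. transpose A = A \<and> (\<forall>x. 0 \<le> x \<bullet> (A *v x)) \<and> A ** A = M"
    using psd_sqrt_exists[OF assms] psd_sqrt_unique by (intro ex_ex1I) auto
  from theI'[OF this] show "transpose (psd_sqrt M) = psd_sqrt M" "psd_sqrt M ** psd_sqrt M = M"
    unfolding psd_sqrt_def by auto
qed

subsection \<open>The standard Gaussian measure\<close>

lemma gaussian_density_prod:
  fixes x :: "real^'n"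
  shows "(2 * pi) powr (- real CARD('n) / 2) * exp (- (norm x)\<^sup>2 / 2)
    = (\<Prod>b\<in>Basis. std_normal_density (x \<bullet> b))"
proof -
  have "(\<Prod>b\<in>Basis. std_normal_density (x \<bullet> b))
      = (1 / sqrt (2 * pi)) ^ DIM(real^'n) * exp (\<Sum>b\<in>Basis. - (x \<bullet> b)\<^sup>2 / 2)"
    by (simp add: std_normal_density_def prod.distrib exp_sum prod_dividef power_divide)
  also have "(\<Sum>b\<in>Basis. - (x \<bullet> b)\<^sup>2 / 2) = - (norm x)\<^sup>2 / 2"
    by (simp add: sum_divide_distrib[symmetric] sum_negf norm_eq_sqrt_inner euclidean_inner[of x x]
        power2_eq_square sum_nonneg)
  also have "(1 / sqrt (2 * pi)) ^ DIM(real^'n) = (2 * pi) powr (- real CARD('n) / 2)"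
    by (simp add: powr_half_sqrt[symmetric] powr_minus_divide[symmetric] powr_powr flip: powr_realpow)
  finally show ?thesis by simp
qed

text \<open>Density and character both factor over the basis and \<open>lborel\<close> is an image
  of a product measure, so Fubini reduces the claim to the one-dimensional normal law.\<close>

lemma char_std_gaussian:
  fixes \<theta> :: "real^'n"
  shows "(\<integral>x. iexp (\<theta> \<bullet> x) \<partial>std_gaussian) = complex_of_real (exp (- (\<theta> \<bullet> \<theta>) / 2))"
proof -
  interpret product_sigma_finite "\<lambda>_. lborel :: real measure" by standard
  let ?g = "\<lambda>b y. std_normal_density y *\<^sub>R iexp ((\<theta> \<bullet> b) * y)"
  have char: "(\<integral>y. ?g b y \<partial>lborel) = complex_of_real (exp (- (\<theta> \<bullet> b)\<^sup>2 / 2))" for b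
    using fun_cong[OF char_std_normal_distribution, of "\<theta> \<bullet> b"]
    by (simp add: char_def integral_density)
  have int: "integrable lborel (?g b)" for b
    by (rule Bochner_Integration.integrable_bound[OF integrable_normal_density[of 1 0]])
      (auto simp: norm_mult)
  have "(\<integral>x. iexp (\<theta> \<bullet> x) \<partial>std_gaussian)
     = (\<integral>x. ((2 * pi) powr (- real CARD('n) / 2) * exp (- (norm x)\<^sup>2 / 2)) *\<^sub>R iexp (\<theta> \<bullet> x) \<partial>(lborel :: (real^'n) measure))"
    unfolding std_gaussian_def by (subst integral_density) auto
  also have "\<dots> = (\<integral>x. (\<Prod>b\<in>Basis. ?g b (x \<bullet> b)) \<partial>(lborel :: (real^'n) measure))"
  proof (rule Bochner_Integration.integral_cong[OF refl])
    fix x :: "real^'n"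
    have "iexp (\<theta> \<bullet> x) = (\<Prod>b\<in>Basis. iexp ((\<theta> \<bullet> b) * (x \<bullet> b)))"
      by (subst euclidean_inner) (simp add: sum_distrib_left exp_sum)
    then show "((2 * pi) powr (- real CARD('n) / 2) * exp (- (norm x)\<^sup>2 / 2)) *\<^sub>R iexp (\<theta> \<bullet> x)
        = (\<Prod>b\<in>Basis. ?g b (x \<bullet> b))"
      unfolding gaussian_density_prod by (simp add: scaleR_conv_of_real prod.distrib)
  qed
  also have "\<dots> = (\<integral>f. (\<Prod>b\<in>Basis. ?g b ((\<Sum>b\<in>Basis. f b *\<^sub>R b) \<bullet> b)) \<partial>(\<Pi>\<^sub>M b\<in>(Basis :: (real^'n) set). lborel))"
    by (subst lborel_eq, subst integral_distr) auto
  also have "\<dots> = (\<integral>f. (\<Prod>b\<in>Basis. ?g b (f b)) \<partial>(\<Pi>\<^sub>M b\<in>(Basis :: (real^'n) set). lborel))"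
    by (simp add: inner_sum_left inner_Basis if_distrib cong: if_cong)
  also have "\<dots> = (\<Prod>b\<in>Basis. complex_of_real (exp (- (\<theta> \<bullet> b)\<^sup>2 / 2)))"
    using product_integral_prod[OF finite_Basis int] by (simp only: char)
  also have "\<dots> = complex_of_real (exp (- (\<theta> \<bullet> \<theta>) / 2))"
    unfolding of_real_prod[symmetric]
    by (simp add: exp_sum[symmetric] euclidean_inner[of \<theta> \<theta>] sum_divide_distrib power2_eq_square sum_negf
        del: of_real_exp)
  finally show ?thesis .
qed

lemma sets_std_gaussian [simp, measurable_cong]: "sets std_gaussian = sets borel"
  by (simp add: std_gaussian_def)

text \<open>The total mass is the characteristic function at 0. A non-integrable function has
  integral 0 by convention, so the value 1 also proves that the measure is finite.\<close>

lemma prob_space_std_gaussian: "prob_space (std_gaussian :: (real^'n) measure)"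
proof -
  have 1: "(\<integral>x. 1 \<partial>(std_gaussian :: (real^'n) measure)) = (1::complex)"
    using char_std_gaussian[of "0 :: real^'n"] by simp
  then have "integrable (std_gaussian :: (real^'n) measure) (\<lambda>_. 1 :: complex)"
    using not_integrable_integral_eq by fastforce
  then have "finite_measure (std_gaussian :: (real^'n) measure)"
    by (intro finite_measureI) (simp add: integrable_iff_bounded)
  then interpret finite_measure "std_gaussian :: (real^'n) measure" .
  have "measure (std_gaussian :: (real^'n) measure) (space std_gaussian) = 1"
    using 1 by (simp add: scaleR_conv_of_real)
  then show ?thesis by (intro prob_spaceI) (simp add: emeasure_eq_measure)
qed

subsection \<open>Environment states seen by the walk\<close>

text \<open>The walk together with its occupation counts: after \<open>t\<close> steps,
  \<open>N s\<close> is the number of times \<open>k < t\<close> at which the state at the walk's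
  space-time point was \<open>s\<close>. The state at time \<open>t\<close> is not yet
  counted.\<close>

fun counted_walk :: "('s \<Rightarrow> 'd pmf) \<Rightarrow> (nat \<times> 'd \<Rightarrow> 's) \<Rightarrow> 'd \<Rightarrow> nat \<Rightarrow> ('d::plus \<times> ('s \<Rightarrow> nat)) pmf" where
  "counted_walk p \<xi> x0 0 = return_pmf (x0, \<lambda>_. 0)"
| "counted_walk p \<xi> x0 (Suc t) =
     bind_pmf (counted_walk p \<xi> x0 t)
       (\<lambda>(x, N). map_pmf (\<lambda>u. (x + u, N(\<xi> (t, x) := Suc (N (\<xi> (t, x)))))) (p (\<xi> (t, x))))"

lemma quenched_law_eq_map_counted_walk:
  "quenched_law P0 c \<xi> x0 t = map_pmf fst (counted_walk (step_pmf P0 c) \<xi> x0 t)"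
  by (induction t) (simp_all add: map_bind_pmf bind_map_pmf case_prod_unfold pmf.map_comp o_def)

lemma counted_walk_cong:
  assumes "\<And>k x. k < t \<Longrightarrow> \<xi> (k, x) = \<zeta> (k, x)"
  shows "counted_walk p \<xi> x0 t = counted_walk p \<zeta> x0 t"
  using assms by (induction t) simp_all

text \<open>Turns an integral over a law that depends on the environment into a sum over
  deterministic points, with weights that are again integrals over that law. Measurability and
  Fubini in the environment can then be argued point by point.\<close>

lemma nn_integral_pmf_conv:
  "(\<integral>\<^sup>+z. f z \<partial>measure_pmf q) = (\<integral>\<^sup>+z. (\<integral>\<^sup>+y. indicator {z} y \<partial>measure_pmf q) * f z \<partial>count_space UNIV)"
  by (simp add: nn_integral_measure_pmf emeasure_pmf_single)

lemma nn_integral_counted_walk_Suc: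
  "(\<integral>\<^sup>+z. f z \<partial>counted_walk p \<xi> x0 (Suc t))
    = (\<integral>\<^sup>+z. (\<lambda>z s. \<integral>\<^sup>+u. f (fst z + u, (snd z)(s := Suc (snd z s))) \<partial>p s) z (\<xi> (t, fst z)) \<partial>counted_walk p \<xi> x0 t)"
  by (simp add: case_prod_unfold)

text \<open>The environment enters through an abstract \<open>X\<close> whose coordinates are
  measurable only before time \<open>t\<close>, so that the result applies both to
  \<open>env_law\<close> and to the product over the past alone. Pairs of position and counts form a
  countable set because \<open>'s\<close> is finite.\<close>

lemma borel_measurable_nn_integral_counted_walk:
  fixes p :: "'s::finite \<Rightarrow> 'd::{plus, countable} pmf"
  assumes "\<And>k x. k < t \<Longrightarrow> (\<lambda>\<omega>. X \<omega> (k, x)) \<in> measurable M (count_space UNIV)"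
  shows "(\<lambda>\<omega>. \<integral>\<^sup>+z. f z \<partial>counted_walk p (X \<omega>) x0 t) \<in> borel_measurable M"
  using assms
proof (induction t arbitrary: f)
  case 0
  then show ?case by simp
next
  case (Suc t)
  define H where "H z s = (\<integral>\<^sup>+u. f (fst z + u, (snd z)(s := Suc (snd z s))) \<partial>p s)" for z s
  have [measurable]: "(\<lambda>\<omega>. \<integral>\<^sup>+y. indicator {z} y \<partial>counted_walk p (X \<omega>) x0 t) \<in> borel_measurable M" for z
    by (rule Suc) (simp add: Suc.prems)
  have [measurable]: "(\<lambda>\<omega>. H z (X \<omega> (t, x))) \<in> borel_measurable M" for z x
    by (rule measurable_compose[OF Suc.prems]) auto
  have "(\<lambda>\<omega>. \<integral>\<^sup>+z. H z (X \<omega> (t, fst z)) \<partial>counted_walk p (X \<omega>) x0 t) \<in> borel_measurable M"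
  proof (subst nn_integral_pmf_conv, rule sigma_finite_measure.borel_measurable_nn_integral)
    show "sigma_finite_measure (count_space (UNIV :: ('d \<times> ('s \<Rightarrow> nat)) set))"
      by (rule sigma_finite_measure_count_space)
    show "case_prod (\<lambda>\<omega> z. (\<integral>\<^sup>+y. indicator {z} y \<partial>counted_walk p (X \<omega>) x0 t) * H z (X \<omega> (t, fst z)))
      \<in> borel_measurable (M \<Otimes>\<^sub>M count_space UNIV)"
      unfolding case_prod_unfold
      by (rule measurable_compose_countable[where g = snd]) measurable
  qed
  then show ?case
    by (simp only: nn_integral_counted_walk_Suc H_def)
qed

section \<open>Independence of the environment at distinct space-time points\<close>

lemma prob_space_env_law: "prob_space (env_law mu)"
  unfolding env_law_def by (intro prob_space_PiM measure_pmf.prob_space_axioms)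

lemma measurable_env_law_component: "(\<lambda>\<xi>. \<xi> i) \<in> measurable (env_law mu) (count_space UNIV)"
  unfolding env_law_def using measurable_component_singleton[of i UNIV "\<lambda>_. measure_pmf mu"] by simp

lemma nn_integral_env_law_component:
  "(\<integral>\<^sup>+\<xi>. h (\<xi> i) \<partial>env_law mu) = (\<integral>\<^sup>+s. h s \<partial>measure_pmf mu)"
proof -
  interpret product_prob_space "\<lambda>_. measure_pmf mu" UNIV
    by standard
  have "(\<integral>\<^sup>+s. h s \<partial>measure_pmf mu) = (\<integral>\<^sup>+s. h s \<partial>distr (env_law mu) (measure_pmf mu) (\<lambda>\<xi>. \<xi> i))"
    unfolding env_law_def by (subst PiM_component) auto
  also have "\<dots> = (\<integral>\<^sup>+\<xi>. h (\<xi> i) \<partial>env_law mu)"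
    by (subst nn_integral_distr) (auto simp: measurable_env_law_component)
  finally show ?thesis by simp
qed

lemma env_law_indep:
  "prob_space.indep_vars (env_law mu) (\<lambda>_. measure_pmf mu) (\<lambda>i \<xi>. \<xi> i) UNIV"
proof -
  interpret prob_space "env_law mu" by (rule prob_space_env_law)
  interpret P: product_prob_space "\<lambda>_. measure_pmf mu" UNIV
    by standard
  have "distr (env_law mu) (PiM UNIV (\<lambda>_. measure_pmf mu)) (\<lambda>\<xi>. \<lambda>i\<in>UNIV. \<xi> i) = env_law mu"
    using distr_id[of "env_law mu"] by (simp add: env_law_def id_def restrict_def)
  also have "\<dots> = (\<Pi>\<^sub>M i\<in>UNIV. distr (env_law mu) (measure_pmf mu) (\<lambda>\<xi>. \<xi> i))"
    unfolding env_law_def by (intro PiM_cong refl P.PiM_component[symmetric])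
  finally show ?thesis
    by (subst indep_vars_iff_distr_eq_PiM') (auto simp: measurable_env_law_component)
qed

text \<open>Meant for \<open>A\<close> the space-time points before time \<open>t\<close> and
  \<open>j\<close> a point at time \<open>t\<close>. Restricting to \<open>A\<close> expresses that
  \<open>g\<close> sees only the past.\<close>

lemma nn_integral_env_law_indep:
  assumes g: "g \<in> borel_measurable (PiM A (\<lambda>_. measure_pmf mu))" and j: "j \<notin> A"
  shows "(\<integral>\<^sup>+\<xi>. g (restrict \<xi> A) * h (\<xi> j) \<partial>env_law mu)
    = (\<integral>\<^sup>+\<xi>. g (restrict \<xi> A) \<partial>env_law mu) * (\<integral>\<^sup>+s. h s \<partial>measure_pmf mu)"
proof -
  interpret prob_space "env_law mu" by (rule prob_space_env_law)
  have "indep_var (PiM A (\<lambda>_. measure_pmf mu)) (\<lambda>\<xi>. restrict (\<lambda>i. \<xi> i) A)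
      (PiM {j} (\<lambda>_. measure_pmf mu)) (\<lambda>\<xi>. restrict (\<lambda>i. \<xi> i) {j})"
    by (rule indep_var_restrict[OF env_law_indep]) (use j in auto)
  then have "indep_var borel (g \<circ> (\<lambda>\<xi>. restrict (\<lambda>i. \<xi> i) A))
      borel ((\<lambda>\<omega>. h (\<omega> j)) \<circ> (\<lambda>\<xi>. restrict (\<lambda>i. \<xi> i) {j}))"
  proof (rule indep_var_compose)
    show "(\<lambda>\<omega>. h (\<omega> j)) \<in> borel_measurable (PiM {j} (\<lambda>_. measure_pmf mu))"
      by (rule measurable_compose[OF measurable_component_singleton]) auto
  qed (rule g)
  moreover have *: "case_bool borel borel = (\<lambda>_::bool. borel :: ennreal measure)"
    by (auto simp: fun_eq_iff split: bool.split)
  ultimately have "indep_vars (\<lambda>_::bool. borel) (case_bool (\<lambda>\<xi>. g (restrict \<xi> A)) (\<lambda>\<xi>. h (\<xi> j))) UNIV"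
    unfolding indep_var_def * by (simp add: o_def)
  from indep_vars_nn_integral[OF _ this] show ?thesis
    by (simp add: UNIV_bool nn_integral_env_law_component mult.commute)
qed

text \<open>The position at time \<open>t\<close> is determined by the environment before time \<open>t\<close>, so the state
  seen there is a fresh sample.\<close>

lemma nn_integral_counted_walk_fresh:
  fixes p :: "'s::finite \<Rightarrow> (int^'n) pmf"
  shows "(\<integral>\<^sup>+\<xi>. \<integral>\<^sup>+z. h z (\<xi> (t, fst z)) \<partial>counted_walk p \<xi> x0 t \<partial>env_law mu)
    = (\<integral>\<^sup>+\<xi>. \<integral>\<^sup>+z. (\<integral>\<^sup>+s. h z s \<partial>measure_pmf mu) \<partial>counted_walk p \<xi> x0 t \<partial>env_law mu)"
proof -
  let ?A = "{..<t} \<times> (UNIV :: (int^'n) set)"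
  let ?q = "\<lambda>z \<xi>. \<integral>\<^sup>+y. indicator {z} y \<partial>counted_walk p \<xi> x0 t"
  have q_eq: "?q z \<xi> = ?q z (restrict \<xi> ?A)" for z \<xi>
    by (subst counted_walk_cong[where \<zeta> = "restrict \<xi> ?A"]) auto
  have qA: "?q z \<in> borel_measurable (PiM ?A (\<lambda>_. measure_pmf mu))" for z
    by (rule borel_measurable_nn_integral_counted_walk)
      (use measurable_component_singleton[of _ ?A "\<lambda>_. measure_pmf mu"] in auto)
  have qm: "?q z \<in> borel_measurable (env_law mu)" for z
    by (intro borel_measurable_nn_integral_counted_walk measurable_env_law_component)
  have hm: "(\<lambda>\<xi>. h z (\<xi> (t, fst z))) \<in> borel_measurable (env_law mu)" for z
    by (rule measurable_compose[OF measurable_env_law_component]) simp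
  have "(\<integral>\<^sup>+\<xi>. \<integral>\<^sup>+z. h z (\<xi> (t, fst z)) \<partial>counted_walk p \<xi> x0 t \<partial>env_law mu)
    = (\<integral>\<^sup>+\<xi>. \<integral>\<^sup>+z. ?q z \<xi> * h z (\<xi> (t, fst z)) \<partial>count_space UNIV \<partial>env_law mu)"
    by (subst nn_integral_pmf_conv) (rule refl)
  \<comment> \<open>After the interchange \<open>z\<close> is fixed, so the point
    \<open>(t, fst z)\<close> is deterministic and independence of coordinates applies; with the
    random position it could not be used directly.\<close>
  also have "\<dots> = (\<integral>\<^sup>+z. \<integral>\<^sup>+\<xi>. ?q z \<xi> * h z (\<xi> (t, fst z)) \<partial>env_law mu \<partial>count_space UNIV)"
    by (rule nn_integral_count_space_nn_integral[OF countableI_type]) (intro borel_measurable_times_ennreal qm hm)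
  also have "\<dots> = (\<integral>\<^sup>+z. \<integral>\<^sup>+\<xi>. ?q z \<xi> * (\<integral>\<^sup>+s. h z s \<partial>measure_pmf mu) \<partial>env_law mu \<partial>count_space UNIV)"
  proof (rule nn_integral_cong)
    fix z
    have "(\<integral>\<^sup>+\<xi>. ?q z \<xi> * h z (\<xi> (t, fst z)) \<partial>env_law mu)
      = (\<integral>\<^sup>+\<xi>. ?q z (restrict \<xi> ?A) * h z (\<xi> (t, fst z)) \<partial>env_law mu)"
      by (subst q_eq) (rule refl)
    also have "\<dots> = (\<integral>\<^sup>+\<xi>. ?q z (restrict \<xi> ?A) \<partial>env_law mu) * (\<integral>\<^sup>+s. h z s \<partial>measure_pmf mu)"
      by (rule nn_integral_env_law_indep[OF qA]) simp
    also have "\<dots> = (\<integral>\<^sup>+\<xi>. ?q z \<xi> * (\<integral>\<^sup>+s. h z s \<partial>measure_pmf mu) \<partial>env_law mu)"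
      unfolding q_eq[symmetric] by (rule nn_integral_multc[OF qm, symmetric])
    finally show "(\<integral>\<^sup>+\<xi>. ?q z \<xi> * h z (\<xi> (t, fst z)) \<partial>env_law mu)
      = (\<integral>\<^sup>+\<xi>. ?q z \<xi> * (\<integral>\<^sup>+s. h z s \<partial>measure_pmf mu) \<partial>env_law mu)" .
  qed
  also have "\<dots> = (\<integral>\<^sup>+\<xi>. \<integral>\<^sup>+z. ?q z \<xi> * (\<integral>\<^sup>+s. h z s \<partial>measure_pmf mu) \<partial>count_space UNIV \<partial>env_law mu)"
    by (rule nn_integral_count_space_nn_integral[OF countableI_type, symmetric])
      (intro borel_measurable_times_ennreal qm borel_measurable_const)
  also have "\<dots> = (\<integral>\<^sup>+\<xi>. \<integral>\<^sup>+z. (\<integral>\<^sup>+s. h z s \<partial>measure_pmf mu) \<partial>counted_walk p \<xi> x0 t \<partial>env_law mu)"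
    by (subst (2) nn_integral_pmf_conv) (rule refl)
  finally show ?thesis .
qed

section \<open>Binomial state counts and almost sure frequencies\<close>

lemma bernoulli_pmf_eq_map: "bernoulli_pmf (pmf mu s) = map_pmf (\<lambda>s'. s' = s) mu"
proof (rule pmf_eqI)
  fix b
  have 1: "measure mu {s'. s' = s} = pmf mu s"
    by (simp add: measure_pmf_single)
  have 2: "measure mu {s'. s' \<noteq> s} = 1 - pmf mu s"
    using measure_pmf.prob_compl[of "{s}" mu] by (simp add: measure_pmf_single Compl_eq_Diff_UNIV[symmetric] Collect_neg_eq)
  show "pmf (bernoulli_pmf (pmf mu s)) b = pmf (map_pmf (\<lambda>s'. s' = s) mu) b"
    using 1 2 by (cases b) (simp_all add: pmf_map vimage_def pmf_le_1)
qed

text \<open>Each step adds a Bernoulli variable that is independent of the position and counts so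
  far, because the state is fresh. \<open>g\<close> is arbitrary in the induction, since one step
  replaces it by its Bernoulli average.\<close>

lemma annealed_count_binomial:
  fixes p :: "'s::finite \<Rightarrow> (int^'n) pmf"
  shows "(\<integral>\<^sup>+\<xi>. \<integral>\<^sup>+z. g (snd z s) \<partial>counted_walk p \<xi> x0 t \<partial>env_law mu)
    = (\<integral>\<^sup>+n. g n \<partial>binomial_pmf t (pmf mu s))"
proof (induction t arbitrary: g)
  case 0
  interpret prob_space "env_law mu" by (rule prob_space_env_law)
  show ?case by (simp add: binomial_pmf_0 pmf_le_1 emeasure_space_1)
next
  case (Suc t)
  define h where "h z s' = g (snd z s + of_bool (s' = s))" for z :: "(int^'n) \<times> ('s \<Rightarrow> nat)" and s'
  have "(\<integral>\<^sup>+\<xi>. \<integral>\<^sup>+z. g (snd z s) \<partial>counted_walk p \<xi> x0 (Suc t) \<partial>env_law mu)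
     = (\<integral>\<^sup>+\<xi>. \<integral>\<^sup>+z. h z (\<xi> (t, fst z)) \<partial>counted_walk p \<xi> x0 t \<partial>env_law mu)"
    by (simp add: case_prod_unfold h_def emeasure_pmf cong: if_cong)
      (auto intro!: nn_integral_cong)
  also have "\<dots> = (\<integral>\<^sup>+\<xi>. \<integral>\<^sup>+z. (\<integral>\<^sup>+s'. g (snd z s + of_bool (s' = s)) \<partial>measure_pmf mu) \<partial>counted_walk p \<xi> x0 t \<partial>env_law mu)"
    unfolding h_def by (rule nn_integral_counted_walk_fresh)
  also have "\<dots> = (\<integral>\<^sup>+n. (\<integral>\<^sup>+s'. g (n + of_bool (s' = s)) \<partial>measure_pmf mu) \<partial>binomial_pmf t (pmf mu s))"
    by (rule Suc.IH)
  also have "\<dots> = (\<integral>\<^sup>+n. (\<integral>\<^sup>+b. g (n + of_bool b) \<partial>bernoulli_pmf (pmf mu s)) \<partial>binomial_pmf t (pmf mu s))"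
    unfolding bernoulli_pmf_eq_map by simp
  also have "\<dots> = (\<integral>\<^sup>+n. g n \<partial>binomial_pmf (Suc t) (pmf mu s))"
  proof -
    have "(\<integral>\<^sup>+n. (\<integral>\<^sup>+b. g (n + of_bool b) \<partial>bernoulli_pmf (pmf mu s)) \<partial>binomial_pmf t (pmf mu s))
      = (\<integral>\<^sup>+n. g n \<partial>bind_pmf (binomial_pmf t (pmf mu s)) (\<lambda>n. bind_pmf (bernoulli_pmf (pmf mu s))
           (\<lambda>b. return_pmf (of_bool b + n))))"
      by (simp add: add.commute)
    \<comment> \<open>\<open>binomial_pmf_Suc\<close> draws the new trial first, the walk draws it
      last; the two draws are independent and may be exchanged.\<close>
    also have "\<dots> = (\<integral>\<^sup>+n. g n \<partial>binomial_pmf (Suc t) (pmf mu s))"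
      by (subst bind_commute_pmf) (simp add: binomial_pmf_Suc pmf_le_1)
    finally show ?thesis .
  qed
  finally show ?case .
qed

text \<open>The quenched deviation probability \<open>f t \<xi>\<close> has a binomial tail as its
  mean, at most \<open>2 * r ^ t\<close> by Hoeffding for \<open>t > 0\<close>. The expected sum is
  finite, so for almost every environment the series converges and its terms vanish.\<close>

lemma count_frequency_tendsto:
  fixes p :: "'s::finite \<Rightarrow> (int^'n) pmf" and mu :: "'s pmf"
  assumes "\<epsilon> > 0"
  shows "AE \<xi> in env_law mu.
    (\<lambda>t. measure_pmf.prob (counted_walk p \<xi> x0 t) {z. \<bar>snd z s / t - pmf mu s\<bar> \<ge> \<epsilon>}) \<longlonglongrightarrow> 0"
proof -
  let ?B = "\<lambda>t. {n. \<bar>real n / real t - pmf mu s\<bar> \<ge> \<epsilon>}"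
  let ?A = "\<lambda>t. {z. \<bar>real (snd z s) / real t - pmf mu s\<bar> \<ge> \<epsilon>} :: ((int^'n) \<times> ('s \<Rightarrow> nat)) set"
  define f where "f t \<xi> = measure_pmf.prob (counted_walk p \<xi> x0 t) (?A t)" for t \<xi>
  have f: "ennreal (f t \<xi>) = (\<integral>\<^sup>+z. indicator (?B t) (snd z s) \<partial>counted_walk p \<xi> x0 t)" for t \<xi>
  proof -
    have "(\<integral>\<^sup>+z. indicator (?B t) (snd z s) \<partial>counted_walk p \<xi> x0 t)
      = (\<integral>\<^sup>+z. indicator (?A t) z \<partial>counted_walk p \<xi> x0 t)"
      by (intro nn_integral_cong) (auto simp: indicator_def)
    then show ?thesis by (simp add: f_def measure_pmf.emeasure_eq_measure)
  qed
  have fm [measurable]: "(\<lambda>\<xi>. ennreal (f t \<xi>)) \<in> borel_measurable (env_law mu)" for t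
    unfolding f by (intro borel_measurable_nn_integral_counted_walk measurable_env_law_component)
  define r where "r = exp (- 2 * \<epsilon>\<^sup>2)"
  have r: "0 < r" "r < 1" using assms by (auto simp: r_def)
  \<comment> \<open>Shifted by one, since the frequency at time 0 is a quotient by zero; the limit
    does not notice the shift.\<close>
  have bound: "(\<integral>\<^sup>+\<xi>. ennreal (f (Suc t) \<xi>) \<partial>env_law mu) \<le> ennreal (2 * r ^ Suc t)" for t
  proof -
    interpret binomial_distribution "Suc t" "pmf mu s"
      by standard (simp add: pmf_le_1)
    have "(\<integral>\<^sup>+\<xi>. ennreal (f (Suc t) \<xi>) \<partial>env_law mu)
      = ennreal (measure_pmf.prob (binomial_pmf (Suc t) (pmf mu s)) (?B (Suc t)))"
      unfolding f annealed_count_binomial by (simp add: measure_pmf.emeasure_eq_measure)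
    also have "\<dots> \<le> ennreal (2 * exp (- 2 * real (Suc t) * \<epsilon>\<^sup>2))"
      using prob_abs_ge'[of \<epsilon>] assms by (intro ennreal_leI) (simp del: of_nat_Suc)
    also have "exp (- 2 * real (Suc t) * \<epsilon>\<^sup>2) = r ^ Suc t"
      unfolding r_def exp_of_nat_mult[symmetric] by (simp add: algebra_simps)
    finally show ?thesis .
  qed
  have "(\<integral>\<^sup>+\<xi>. (\<Sum>t. ennreal (f (Suc t) \<xi>)) \<partial>env_law mu) = (\<Sum>t. \<integral>\<^sup>+\<xi>. ennreal (f (Suc t) \<xi>) \<partial>env_law mu)"
    by (rule nn_integral_suminf[OF fm])
  also have "\<dots> \<le> (\<Sum>t. ennreal (2 * r ^ Suc t))"
    by (intro suminf_le bound) auto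
  also have "\<dots> < \<infinity>"
    using r by (subst suminf_ennreal2) (auto simp del: power_Suc simp: summable_Suc_iff intro!: summable_mult summable_geometric)
  finally have "AE \<xi> in env_law mu. (\<Sum>t. ennreal (f (Suc t) \<xi>)) \<noteq> \<infinity>"
    by (intro nn_integral_PInf_AE) auto
  then show ?thesis
  proof eventually_elim
    case (elim \<xi>)
    then have "summable (\<lambda>t. f (Suc t) \<xi>)"
      by (intro summable_suminf_not_top) (auto simp: f_def)
    then have "(\<lambda>t. f (Suc t) \<xi>) \<longlonglongrightarrow> 0" by (rule summable_LIMSEQ_zero)
    then show ?case unfolding f_def by (subst (asm) filterlim_sequentially_Suc)
  qed
qed

subsection \<open>Quenched characteristic functions\<close>

lemma expectation_bind_pmf_finite:
  fixes h :: "'b \<Rightarrow> 'c::{banach, second_countable_topology}"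
  assumes "finite (set_pmf q)" "\<And>x. finite (set_pmf (f x))"
  shows "measure_pmf.expectation (bind_pmf q f) h
    = measure_pmf.expectation q (\<lambda>x. measure_pmf.expectation (f x) h)"
  using assms by (subst pmf_expectation_bind[of "set_pmf q"]) (auto simp: integral_measure_pmf[of "set_pmf q"])

lemma finite_set_counted_walk:
  assumes "\<And>s. finite (set_pmf (p s))"
  shows "finite (set_pmf (counted_walk p \<xi> x0 t))"
  using assms by (induction t) auto

lemma counted_walk_count_le:
  "z \<in> set_pmf (counted_walk p \<xi> x0 t) \<Longrightarrow> snd z s \<le> t"
proof (induction t arbitrary: z)
  case (Suc t)
  then obtain y u where y: "y \<in> set_pmf (counted_walk p \<xi> x0 t)"
    and "z = (fst y + u, (snd y)(\<xi> (t, fst y) := Suc (snd y (\<xi> (t, fst y)))))"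
    by (auto simp: case_prod_unfold)
  then show ?case using Suc.IH[OF y] by (auto simp: le_Suc_eq)
qed simp

lemma expectation_counted_walk_Suc:
  fixes f :: "_ \<Rightarrow> 'c::{banach, second_countable_topology}"
  assumes "\<And>s. finite (set_pmf (p s))"
  shows "measure_pmf.expectation (counted_walk p \<xi> x0 (Suc t)) f
    = measure_pmf.expectation (counted_walk p \<xi> x0 t) (\<lambda>z. measure_pmf.expectation (p (\<xi> (t, fst z)))
        (\<lambda>u. f (fst z + u, (snd z)(\<xi> (t, fst z) := Suc (snd z (\<xi> (t, fst z)))))))"
  by (simp add: expectation_bind_pmf_finite finite_set_counted_walk assms case_prod_unfold)

lemma norm_expectation_pmf_le:
  fixes f :: "'a \<Rightarrow> 'c::{banach, second_countable_topology}"
  assumes "finite (set_pmf q)" "\<And>x. x \<in> set_pmf q \<Longrightarrow> norm (f x) \<le> g x"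
  shows "norm (measure_pmf.expectation q f) \<le> measure_pmf.expectation q g"
proof -
  have "norm (measure_pmf.expectation q f) \<le> measure_pmf.expectation q (\<lambda>x. norm (f x))"
    by (rule integral_norm_bound)
  also have "\<dots> \<le> measure_pmf.expectation q g"
    using assms by (intro integral_mono_AE integrable_measure_pmf_finite) (auto simp: AE_measure_pmf_iff)
  finally show ?thesis .
qed

lemma norm_expectation_pmf_le_const:
  fixes f :: "'a \<Rightarrow> 'c::{banach, second_countable_topology}"
  assumes "finite (set_pmf q)" "\<And>x. x \<in> set_pmf q \<Longrightarrow> norm (f x) \<le> B"
  shows "norm (measure_pmf.expectation q f) \<le> B"
  using norm_expectation_pmf_le[of q f "\<lambda>_. B"] assms by simp

lemma ivec_add: "ivec (x + y) = ivec x + ivec y"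
  by (simp add: ivec_def vec_eq_iff)

lemma iexp_quadratic_approx: "cmod (iexp x - (1 + \<i> * x - x\<^sup>2 / 2)) \<le> \<bar>x\<bar> ^ 3 / 6"
proof -
  have "(\<Sum>k\<le>2. (\<i> * complex_of_real x) ^ k / fact k) = 1 + \<i> * x - x\<^sup>2 / 2"
  proof -
    have "{..2::nat} = {0, 1, 2}" by auto
    then show ?thesis by (simp add: power_mult_distrib fact_2)
  qed
  then show ?thesis using iexp_approx1[of x 2] by (simp add: numeral_3_eq_3 numeral_2_eq_2)
qed

text \<open>Lipschitz bound for \<open>exp\<close> below \<open>c\<close>, used to replace the
  random accumulated variance by its limit inside an exponential.\<close>

lemma exp_diff_le:
  fixes a b :: real
  assumes "a \<le> c" "b \<le> c"
  shows "\<bar>exp a - exp b\<bar> \<le> exp c * \<bar>a - b\<bar>"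
proof -
  have *: "exp y - exp x \<le> exp c * (y - x)" if "x \<le> y" "y \<le> c" for x y :: real
  proof -
    have "exp y - exp x = exp y * (1 - exp (x - y))" by (simp add: right_diff_distrib flip: exp_add)
    also have "1 - exp (x - y) \<le> y - x" using exp_ge_add_one_self[of "x - y"] by linarith
    then have "exp y * (1 - exp (x - y)) \<le> exp y * (y - x)" by (intro mult_left_mono) auto
    also have "\<dots> \<le> exp c * (y - x)" using that by (intro mult_right_mono) auto
    finally show ?thesis .
  qed
  show ?thesis
  proof (cases "a \<le> b")
    case True
    then show ?thesis using *[of a b] assms by (simp add: abs_if)
  next
    case False
    then show ?thesis using *[of b a] assms by (simp add: abs_if)
  qed
qed

section \<open>Walks with finite jump range and a drift common to all states\<close>

locale finite_range_steps =
  fixes p :: "'s::finite \<Rightarrow> (int^'n) pmf" and b :: "real^'n"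
  assumes finite_steps: "finite (set_pmf (p s))"
    and drift: "measure_pmf.expectation (p s) ivec = b"
begin

definition step_var :: "real^'n \<Rightarrow> 's \<Rightarrow> real" where
  "step_var \<theta> s = measure_pmf.expectation (p s) (\<lambda>u. (\<theta> \<bullet> (ivec u - b))\<^sup>2)"

definition step_char :: "real^'n \<Rightarrow> 's \<Rightarrow> complex" where
  "step_char \<theta> s = measure_pmf.expectation (p s) (\<lambda>u. iexp (\<theta> \<bullet> (ivec u - b)))"

text \<open>The projection of \<open>Y\<close> onto \<open>\<theta>\<close>. It is not centred at
  \<open>x0\<close>; the starting value \<open>\<theta> \<bullet> ivec x0\<close> disappears only
  through the scaling.\<close>

definition dev :: "real^'n \<Rightarrow> nat \<Rightarrow> int^'n \<Rightarrow> real" where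
  "dev \<theta> t x = \<theta> \<bullet> (ivec x - real t *\<^sub>R b)"

lemma dev_Suc: "dev \<theta> (Suc t) (x + u) = dev \<theta> t x + \<theta> \<bullet> (ivec u - b)"
  by (simp add: dev_def ivec_add inner_simps algebra_simps)

lemma integrable_steps [simp]:
  fixes f :: "int^'n \<Rightarrow> 'c::{banach, second_countable_topology}"
  shows "integrable (measure_pmf (p s)) f"
  by (intro integrable_measure_pmf_finite finite_steps)

lemma integrable_walk [simp]:
  fixes f :: "(int^'n) \<times> ('s \<Rightarrow> nat) \<Rightarrow> 'c::{banach, second_countable_topology}"
  shows "integrable (measure_pmf (counted_walk p \<xi> x0 t)) f"
  by (intro integrable_measure_pmf_finite finite_set_counted_walk finite_steps)

lemma step_var_nonneg: "step_var \<theta> s \<ge> 0"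
  by (simp add: step_var_def)

lemma step_centered: "measure_pmf.expectation (p s) (\<lambda>u. \<theta> \<bullet> (ivec u - b)) = 0"
  using drift[of s] by simp

text \<open>Orthogonality of martingale increments: the cross term vanishes by
  \<open>step_centered\<close>. Summing the variance over all states is a crude bound for the
  variance in whichever state is met.\<close>

lemma dev_second_moment:
  "measure_pmf.expectation (counted_walk p \<xi> x0 t) (\<lambda>z. (dev \<theta> t (fst z))\<^sup>2)
    \<le> (\<theta> \<bullet> ivec x0)\<^sup>2 + real t * (\<Sum>s\<in>UNIV. step_var \<theta> s)"
proof (induction t)
  case 0
  then show ?case by (simp add: dev_def)
next
  case (Suc t)
  let ?E = "measure_pmf.expectation (counted_walk p \<xi> x0 t)"
  have step: "measure_pmf.expectation (p s) (\<lambda>u. (dev \<theta> (Suc t) (x + u))\<^sup>2) = (dev \<theta> t x)\<^sup>2 + step_var \<theta> s" for x s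
  proof -
    have "(dev \<theta> (Suc t) (x + u))\<^sup>2
      = (dev \<theta> t x)\<^sup>2 + (\<theta> \<bullet> (ivec u - b))\<^sup>2 + 2 * dev \<theta> t x * (\<theta> \<bullet> (ivec u - b))" for u
      by (simp only: dev_Suc power2_sum)
    then show ?thesis
      by (simp only: Bochner_Integration.integral_add[OF integrable_steps integrable_steps]
          integral_mult_right_zero step_centered) (simp add: step_var_def)
  qed
  have "measure_pmf.expectation (counted_walk p \<xi> x0 (Suc t)) (\<lambda>z. (dev \<theta> (Suc t) (fst z))\<^sup>2)
     = ?E (\<lambda>z. (dev \<theta> t (fst z))\<^sup>2 + step_var \<theta> (\<xi> (t, fst z)))"
    by (subst expectation_counted_walk_Suc[OF finite_steps]) (simp add: step)
  also have "\<dots> \<le> ?E (\<lambda>z. (dev \<theta> t (fst z))\<^sup>2 + (\<Sum>s\<in>UNIV. step_var \<theta> s))"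
    by (intro integral_mono integrable_walk add_left_mono member_le_sum) (auto simp: step_var_nonneg)
  also have "\<dots> = ?E (\<lambda>z. (dev \<theta> t (fst z))\<^sup>2) + (\<Sum>s\<in>UNIV. step_var \<theta> s)"
    by simp
  finally show ?case using Suc by (simp add: algebra_simps)
qed

text \<open>Second-order Taylor expansion under the expectation; the linear term vanishes because
  the jump is centred.\<close>

lemma step_char_approx:
  "cmod (step_char (h *\<^sub>R \<theta>) s - (1 - h\<^sup>2 * step_var \<theta> s / 2))
    \<le> \<bar>h\<bar> ^ 3 * measure_pmf.expectation (p s) (\<lambda>u. \<bar>\<theta> \<bullet> (ivec u - b)\<bar> ^ 3 / 6)"
proof -
  let ?w = "\<lambda>u. \<theta> \<bullet> (ivec u - b)"
  let ?E = "measure_pmf.expectation (p s)"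
  have "?E (\<lambda>u. 1 + \<i> * complex_of_real (h * ?w u) - complex_of_real ((h * ?w u)\<^sup>2) / 2)
    = 1 + \<i> * complex_of_real (h * ?E ?w) - complex_of_real (h\<^sup>2 * ?E (\<lambda>u. (?w u)\<^sup>2)) / 2"
    by (simp add: power_mult_distrib integral_complex_of_real del: of_real_mult of_real_power)
  then have "step_char (h *\<^sub>R \<theta>) s - (1 - h\<^sup>2 * step_var \<theta> s / 2)
    = ?E (\<lambda>u. iexp (h * ?w u) - (1 + \<i> * complex_of_real (h * ?w u) - complex_of_real ((h * ?w u)\<^sup>2) / 2))"
    by (simp add: step_char_def step_var_def step_centered)
  also have "cmod \<dots> \<le> ?E (\<lambda>u. \<bar>h\<bar> ^ 3 * (\<bar>?w u\<bar> ^ 3 / 6))"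
    by (rule norm_expectation_pmf_le[OF finite_steps])
      (use iexp_quadratic_approx[of "h * ?w _"] in \<open>simp add: abs_mult power_mult_distrib\<close>)
  finally show ?thesis by simp
qed

text \<open>Summing over the states bounds the error of the state actually met, uniformly in
  position, time and environment.\<close>

definition step_error :: "real^'n \<Rightarrow> real \<Rightarrow> real" where
  "step_error \<theta> h = (\<Sum>s\<in>UNIV. cmod (step_char (h *\<^sub>R \<theta>) s * exp (h\<^sup>2 * step_var \<theta> s / 2) - 1))"

text \<open>Two errors survive multiplication by \<open>t\<close>: the Taylor remainder, of order
  \<open>t powr (-3/2)\<close>, and \<open>(1 - x) * exp x - 1\<close>, which is quadratic in
  \<open>x = v / (2 * t)\<close>.\<close>

lemma step_error_tendsto: "(\<lambda>t. real t * step_error \<theta> (1 / sqrt (real t))) \<longlonglongrightarrow> 0"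
proof -
  have "(\<lambda>t. real t * cmod (step_char ((1 / sqrt (real t)) *\<^sub>R \<theta>) s * exp ((1 / sqrt (real t))\<^sup>2 * step_var \<theta> s / 2) - 1)) \<longlonglongrightarrow> 0" for s
  proof (rule tendsto_sandwich[OF _ _ tendsto_const])
    define v where "v = step_var \<theta> s"
    define m where "m = measure_pmf.expectation (p s) (\<lambda>u. \<bar>\<theta> \<bullet> (ivec u - b)\<bar> ^ 3 / 6)"
    let ?bound = "\<lambda>t::nat. real t * ((1 / sqrt (real t)) ^ 3 * m * exp (v / (2 * real t)) + \<bar>(1 - v / (2 * real t)) * exp (v / (2 * real t)) - 1\<bar>)"
    show "\<forall>\<^sub>F t in sequentially. real t * cmod (step_char ((1 / sqrt (real t)) *\<^sub>R \<theta>) s * exp ((1 / sqrt (real t))\<^sup>2 * step_var \<theta> s / 2) - 1) \<le> ?bound t"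
    proof (rule eventually_sequentiallyI[of 1])
      fix t :: nat assume t: "1 \<le> t"
      define h where "h = 1 / sqrt (real t)"
      have h2: "h\<^sup>2 * v / 2 = v / (2 * real t)" and h0: "h > 0" using t by (simp_all add: h_def power_divide)
      let ?e = "exp (h\<^sup>2 * v / 2)" and ?a = "1 - h\<^sup>2 * v / 2"
      have "cmod (step_char (h *\<^sub>R \<theta>) s * complex_of_real ?e - 1)
        = cmod ((step_char (h *\<^sub>R \<theta>) s - complex_of_real ?a) * complex_of_real ?e + complex_of_real (?a * ?e - 1))"
        by (simp add: algebra_simps del: of_real_exp)
      also have "\<dots> \<le> cmod (step_char (h *\<^sub>R \<theta>) s - complex_of_real ?a) * ?e + \<bar>?a * ?e - 1\<bar>"
        by (rule order_trans[OF norm_triangle_ineq]) (simp add: norm_mult del: of_real_exp of_real_mult of_real_diff)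
      also have "\<dots> \<le> (\<bar>h\<bar> ^ 3 * m) * ?e + \<bar>?a * ?e - 1\<bar>"
        using step_char_approx[of h \<theta> s] by (intro add_right_mono mult_right_mono) (simp_all add: v_def m_def)
      finally show "real t * cmod (step_char ((1 / sqrt (real t)) *\<^sub>R \<theta>) s * exp ((1 / sqrt (real t))\<^sup>2 * step_var \<theta> s / 2) - 1) \<le> ?bound t"
        using h0 unfolding h_def[symmetric] v_def[symmetric] h2 by (intro mult_left_mono) auto
    qed
    have "(\<lambda>t::nat. real t * ((1 / sqrt (real t)) ^ 3 * exp (v / (2 * real t)))) \<longlonglongrightarrow> 0"
      by real_asymp
    from tendsto_mult_right_zero[OF this, of m]
    have "(\<lambda>t::nat. real t * ((1 / sqrt (real t)) ^ 3 * m * exp (v / (2 * real t)))) \<longlonglongrightarrow> 0"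
      by (simp add: mult_ac)
    moreover have "(\<lambda>t::nat. real t * ((1 - v / (2 * real t)) * exp (v / (2 * real t)) - 1)) \<longlonglongrightarrow> 0"
    \<comment> \<open>The asymptotic expansion needs the sign of \<open>v\<close>; for
      \<open>v = 0\<close> the sequence is identically 0.\<close>
    proof (cases "v = 0")
      case False
      then have "v > 0" using step_var_nonneg[of \<theta> s] by (simp add: v_def)
      then show ?thesis by real_asymp
    qed simp
    from tendsto_rabs_zero[OF this]
    have "(\<lambda>t::nat. real t * \<bar>(1 - v / (2 * real t)) * exp (v / (2 * real t)) - 1\<bar>) \<longlonglongrightarrow> 0"
      by (simp add: abs_mult)
    ultimately show "?bound \<longlonglongrightarrow> 0"
      unfolding distrib_left by (rule tendsto_add_zero)
  qed auto
  then have "(\<lambda>t. \<Sum>s\<in>UNIV. real t * cmod (step_char ((1 / sqrt (real t)) *\<^sub>R \<theta>) s * exp ((1 / sqrt (real t))\<^sup>2 * step_var \<theta> s / 2) - 1)) \<longlonglongrightarrow> (\<Sum>s\<in>(UNIV::'s set). 0)"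
    by (intro tendsto_sum)
  then show ?thesis by (simp add: step_error_def sum_distrib_left)
qed

section \<open>The predictable quadratic variation and the compensated exponential\<close>

definition accumulated_var :: "real^'n \<Rightarrow> ('s \<Rightarrow> nat) \<Rightarrow> real" where
  "accumulated_var \<theta> N = (\<Sum>s\<in>UNIV. real (N s) * step_var \<theta> s)"

lemma accumulated_var_Suc: "accumulated_var \<theta> (N(s := Suc (N s))) = accumulated_var \<theta> N + step_var \<theta> s"
proof -
  have "accumulated_var \<theta> (N(s := Suc (N s)))
    = (\<Sum>s'\<in>UNIV. real (N s') * step_var \<theta> s' + (if s' = s then step_var \<theta> s else 0))"
    unfolding accumulated_var_def by (intro sum.cong) (auto simp: algebra_simps)
  then show ?thesis by (simp add: sum.distrib accumulated_var_def)
qed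

lemma accumulated_var_le:
  assumes "\<And>s. N s \<le> t"
  shows "accumulated_var \<theta> N \<le> real t * (\<Sum>s\<in>UNIV. step_var \<theta> s)"
  unfolding accumulated_var_def sum_distrib_left
  using assms by (intro sum_mono mult_right_mono step_var_nonneg) simp

text \<open>
  Dividing by \<open>step_char\<close> would give an exact martingale; the real exponential of the variance replaces
  \<open>1 / step_char\<close> up to \<open>o(1/t)\<close> and avoids complex logarithms.
\<close>

definition compensated :: "real^'n \<Rightarrow> real \<Rightarrow> nat \<Rightarrow> (int^'n) \<times> ('s \<Rightarrow> nat) \<Rightarrow> complex" where
  "compensated \<theta> h k z = iexp (h * dev \<theta> k (fst z)) * exp (h\<^sup>2 * accumulated_var \<theta> (snd z) / 2)"

text \<open>Both exponentials are multiplicative along the path, so averaging one jump multiplies by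
  a factor that depends on the state alone and differs from 1 by at most
  \<open>step_error\<close>.\<close>

lemma expectation_compensated_step:
  "measure_pmf.expectation (p s) (\<lambda>u. compensated \<theta> h (Suc k) (x + u, N(s := Suc (N s))))
    = compensated \<theta> h k (x, N) * (step_char (h *\<^sub>R \<theta>) s * exp (h\<^sup>2 * step_var \<theta> s / 2))"
proof -
  have "compensated \<theta> h (Suc k) (x + u, N(s := Suc (N s)))
    = (compensated \<theta> h k (x, N) * complex_of_real (exp (h\<^sup>2 * step_var \<theta> s / 2))) * iexp ((h *\<^sub>R \<theta>) \<bullet> (ivec u - b))" for u
    by (simp add: compensated_def dev_Suc accumulated_var_Suc distrib_left exp_add add_divide_distrib mult_ac)
  then show ?thesis by (simp add: step_char_def mult_ac)
qed

text \<open>Counts never exceed the elapsed time, so with \<open>h\<^sup>2 = 1 / t\<close> and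
  \<open>k \<le> t\<close> the exponent is bounded uniformly. For \<open>t = 0\<close> the factor
  \<open>1 / sqrt 0\<close> is 0 and the modulus is 1.\<close>

lemma cmod_compensated_le:
  assumes "z \<in> set_pmf (counted_walk p \<xi> x0 k)" "k \<le> t"
  shows "cmod (compensated \<theta> (1 / sqrt (real t)) k z) \<le> exp ((\<Sum>s\<in>UNIV. step_var \<theta> s) / 2)"
proof (cases "t = 0")
  case True
  then show ?thesis by (simp add: compensated_def norm_mult sum_nonneg step_var_nonneg)
next
  case False
  have "accumulated_var \<theta> (snd z) \<le> real t * (\<Sum>s\<in>UNIV. step_var \<theta> s)"
    using counted_walk_count_le[OF assms(1)] assms(2) by (intro accumulated_var_le) (meson order_trans)
  then show ?thesis
    using False by (simp add: compensated_def norm_mult power_divide field_simps)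
qed

text \<open>The horizon \<open>t\<close> fixes the scale while \<open>k\<close> runs up to it, hence
  the two indices of \<open>?G\<close>. Telescoping adds \<open>t\<close> errors of size
  \<open>B * step_error\<close>; the initial value tends to 1 because the starting point is divided
  by \<open>sqrt t\<close>.\<close>

lemma expectation_compensated_tendsto:
  "(\<lambda>t. measure_pmf.expectation (counted_walk p \<xi> x0 t) (compensated \<theta> (1 / sqrt (real t)) t)) \<longlonglongrightarrow> 1"
proof -
  define B where "B = exp ((\<Sum>s\<in>UNIV. step_var \<theta> s) / 2)"
  let ?G = "\<lambda>t k. measure_pmf.expectation (counted_walk p \<xi> x0 k) (compensated \<theta> (1 / sqrt (real t)) k)"
  let ?K = "\<lambda>t s. step_char ((1 / sqrt (real t)) *\<^sub>R \<theta>) s * exp ((1 / sqrt (real t))\<^sup>2 * step_var \<theta> s / 2)"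
  have step: "cmod (?G t (Suc k) - ?G t k) \<le> B * step_error \<theta> (1 / sqrt (real t))" if "k < t" for t k
  proof -
    have "?G t (Suc k) = measure_pmf.expectation (counted_walk p \<xi> x0 k)
        (\<lambda>z. compensated \<theta> (1 / sqrt (real t)) k z * ?K t (\<xi> (k, fst z)))"
      by (subst expectation_counted_walk_Suc[OF finite_steps]) (simp only: expectation_compensated_step prod.collapse)
    then have "?G t (Suc k) - ?G t k = measure_pmf.expectation (counted_walk p \<xi> x0 k)
        (\<lambda>z. compensated \<theta> (1 / sqrt (real t)) k z * ?K t (\<xi> (k, fst z)) - compensated \<theta> (1 / sqrt (real t)) k z)"
      by (simp only: Bochner_Integration.integral_diff[OF integrable_walk integrable_walk])
    also have "cmod \<dots> \<le> B * step_error \<theta> (1 / sqrt (real t))"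
    proof (rule norm_expectation_pmf_le_const)
      show "finite (set_pmf (counted_walk p \<xi> x0 k))"
        by (intro finite_set_counted_walk finite_steps)
      fix z assume z: "z \<in> set_pmf (counted_walk p \<xi> x0 k)"
      have "cmod (compensated \<theta> (1 / sqrt (real t)) k z * ?K t (\<xi> (k, fst z)) - compensated \<theta> (1 / sqrt (real t)) k z)
        = cmod (compensated \<theta> (1 / sqrt (real t)) k z) * cmod (?K t (\<xi> (k, fst z)) - 1)"
        by (simp only: norm_mult[symmetric] right_diff_distrib mult_1_right)
      also have "\<dots> \<le> B * step_error \<theta> (1 / sqrt (real t))"
        unfolding B_def step_error_def using that
        by (intro mult_mono cmod_compensated_le[OF z] member_le_sum[where f = "\<lambda>s. cmod (?K t s - 1)"]) auto
      finally show "cmod (compensated \<theta> (1 / sqrt (real t)) k z * ?K t (\<xi> (k, fst z)) - compensated \<theta> (1 / sqrt (real t)) k z)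
        \<le> B * step_error \<theta> (1 / sqrt (real t))" .
    qed
    finally show ?thesis .
  qed
  have "cmod (?G t t - ?G t 0) \<le> B * (real t * step_error \<theta> (1 / sqrt (real t)))" for t
  proof -
    have "?G t t - ?G t 0 = (\<Sum>k<t. ?G t (Suc k) - ?G t k)"
      by (rule sum_lessThan_telescope[symmetric])
    also have "cmod \<dots> \<le> (\<Sum>k<t. B * step_error \<theta> (1 / sqrt (real t)))"
      by (intro sum_norm_le step) simp
    finally show ?thesis by (simp add: mult_ac)
  qed
  then have "(\<lambda>t. ?G t t - ?G t 0) \<longlonglongrightarrow> 0"
    by (intro Lim_null_comparison[OF always_eventually tendsto_mult_right_zero[OF step_error_tendsto]] allI)
  moreover have "(\<lambda>t. ?G t 0) \<longlonglongrightarrow> 1"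
  proof -
    have "(\<lambda>t. iexp (1 / sqrt (real t) * dev \<theta> 0 x0)) \<longlonglongrightarrow> iexp (0 * dev \<theta> 0 x0)"
    proof -
      have "(\<lambda>t. 1 / sqrt (real t)) \<longlonglongrightarrow> 0" by real_asymp
      then show ?thesis by (intro tendsto_exp tendsto_mult tendsto_const tendsto_of_real)
    qed
    then show ?thesis by (simp add: compensated_def accumulated_var_def)
  qed
  ultimately show ?thesis using tendsto_add by fastforce
qed

section \<open>Limits of the quenched characteristic functions\<close>

text \<open>Convergence in probability upgrades to convergence in mean, because frequency and
  \<open>q\<close> both lie between 0 and 1.\<close>

lemma expectation_frequency_tendsto:
  assumes freq: "\<And>\<epsilon>. \<epsilon> > 0 \<Longrightarrow>
    (\<lambda>t. measure_pmf.prob (counted_walk p \<xi> x0 t) {z. \<bar>snd z s / t - q\<bar> \<ge> \<epsilon>}) \<longlonglongrightarrow> 0"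
    and q: "0 \<le> q" "q \<le> 1"
  shows "(\<lambda>t. measure_pmf.expectation (counted_walk p \<xi> x0 t) (\<lambda>z. \<bar>snd z s / t - q\<bar>)) \<longlonglongrightarrow> 0"
proof (rule LIMSEQ_I)
  fix r :: real assume "r > 0"
  let ?E = "\<lambda>t. measure_pmf.expectation (counted_walk p \<xi> x0 t)"
  let ?A = "\<lambda>t. {z. \<bar>snd z s / t - q\<bar> \<ge> r / 2} :: ((int^'n) \<times> ('s \<Rightarrow> nat)) set"
  have "r / 2 > 0" using \<open>r > 0\<close> by simp
  from LIMSEQ_D[OF freq[OF this] this] obtain t0 where
    t0: "\<And>t. t \<ge> t0 \<Longrightarrow> measure_pmf.prob (counted_walk p \<xi> x0 t) (?A t) < r / 2" by auto
  have le: "?E t (\<lambda>z. \<bar>snd z s / t - q\<bar>) \<le> r / 2 + measure_pmf.prob (counted_walk p \<xi> x0 t) (?A t)" for t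
  proof -
    have "?E t (\<lambda>z. \<bar>snd z s / t - q\<bar>) \<le> ?E t (\<lambda>z. r / 2 + indicator (?A t) z)"
    proof (intro integral_mono_AE integrable_walk AE_pmfI)
      fix z assume "z \<in> set_pmf (counted_walk p \<xi> x0 t)"
      from counted_walk_count_le[OF this, of s] have "snd z s / real t \<le> 1"
        by (cases "t = 0") simp_all
      moreover have "0 \<le> snd z s / real t" by simp
      ultimately have "\<bar>snd z s / t - q\<bar> \<le> 1" using q unfolding abs_le_iff by linarith
      then show "\<bar>snd z s / t - q\<bar> \<le> r / 2 + indicator (?A t) z"
        using \<open>r > 0\<close> by (auto simp: indicator_def)
    qed
    then show ?thesis by simp
  qed
  have "norm (?E t (\<lambda>z. \<bar>snd z s / t - q\<bar>) - 0) < r" if "t \<ge> t0" for t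
    using le[of t] t0[OF that] by simp
  then show "\<exists>t0. \<forall>t\<ge>t0. norm (?E t (\<lambda>z. \<bar>snd z s / t - q\<bar>) - 0) < r" by blast
qed

text \<open>The random factor in \<open>compensated\<close> is exchanged for the constant
  \<open>exp (\<sigma>2 / 2)\<close>, which is then divided out. As \<open>V\<close> bounds both
  exponents, the cost of the exchange is at most \<open>D t\<close>, a combination of mean frequency
  errors.\<close>

lemma characteristic_function_tendsto:
  assumes freq: "\<And>s \<epsilon>. \<epsilon> > 0 \<Longrightarrow>
    (\<lambda>t. measure_pmf.prob (counted_walk p \<xi> x0 t) {z. \<bar>snd z s / t - q s\<bar> \<ge> \<epsilon>}) \<longlonglongrightarrow> 0"
    and q: "\<And>s. 0 \<le> q s" "\<And>s. q s \<le> 1"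
  shows "(\<lambda>t. measure_pmf.expectation (counted_walk p \<xi> x0 t) (\<lambda>z. iexp (1 / sqrt (real t) * dev \<theta> t (fst z))))
    \<longlonglongrightarrow> complex_of_real (exp (- (\<Sum>s\<in>UNIV. q s * step_var \<theta> s) / 2))"
proof -
  let ?E = "\<lambda>t. measure_pmf.expectation (counted_walk p \<xi> x0 t)"
  define V where "V = (\<Sum>s\<in>UNIV. step_var \<theta> s) / 2"
  define \<sigma>2 where "\<sigma>2 = (\<Sum>s\<in>UNIV. q s * step_var \<theta> s)"
  define \<phi> where "\<phi> t = ?E t (\<lambda>z. iexp (1 / sqrt (real t) * dev \<theta> t (fst z)))" for t
  define D where "D t = exp V * (\<Sum>s\<in>UNIV. step_var \<theta> s * ?E t (\<lambda>z. \<bar>snd z s / t - q s\<bar>))" for t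
  have "\<sigma>2 / 2 \<le> V"
    unfolding \<sigma>2_def V_def using q
    by (intro divide_right_mono sum_mono mult_left_le_one_le) (auto simp: step_var_nonneg)
  have bound: "cmod (?E t (compensated \<theta> (1 / sqrt (real t)) t) - complex_of_real (exp (\<sigma>2 / 2)) * \<phi> t) \<le> D t"
    if t: "t \<ge> 1" for t
  proof -
    let ?a = "\<lambda>z. (1 / sqrt (real t))\<^sup>2 * accumulated_var \<theta> (snd z) / 2"
    have "?E t (compensated \<theta> (1 / sqrt (real t)) t) - complex_of_real (exp (\<sigma>2 / 2)) * \<phi> t
      = ?E t (\<lambda>z. compensated \<theta> (1 / sqrt (real t)) t z
          - complex_of_real (exp (\<sigma>2 / 2)) * iexp (1 / sqrt (real t) * dev \<theta> t (fst z)))"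
      unfolding \<phi>_def by (simp del: of_real_exp)
    also have "\<dots> = ?E t (\<lambda>z. iexp (1 / sqrt (real t) * dev \<theta> t (fst z)) * complex_of_real (exp (?a z) - exp (\<sigma>2 / 2)))"
      by (simp add: compensated_def algebra_simps del: of_real_exp)
    also have "cmod \<dots> \<le> ?E t (\<lambda>z. exp V * (\<Sum>s\<in>UNIV. step_var \<theta> s * \<bar>snd z s / t - q s\<bar>))"
    proof (rule norm_expectation_pmf_le)
      show "finite (set_pmf (counted_walk p \<xi> x0 t))"
        by (intro finite_set_counted_walk finite_steps)
      fix z assume z: "z \<in> set_pmf (counted_walk p \<xi> x0 t)"
      have a: "?a z = (\<Sum>s\<in>UNIV. step_var \<theta> s * (snd z s / t)) / 2"
        using t by (simp add: accumulated_var_def power_divide sum_divide_distrib mult.commute)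
      have "?a z \<le> V"
        using accumulated_var_le[of "snd z" t \<theta>] counted_walk_count_le[OF z] t
        by (simp add: V_def power_divide field_simps)
      have "cmod (iexp (1 / sqrt (real t) * dev \<theta> t (fst z)) * complex_of_real (exp (?a z) - exp (\<sigma>2 / 2)))
        = \<bar>exp (?a z) - exp (\<sigma>2 / 2)\<bar>"
        by (simp only: norm_mult norm_exp_i_times norm_of_real mult_1_left)
      also have "\<dots> \<le> exp V * \<bar>?a z - \<sigma>2 / 2\<bar>"
        by (rule exp_diff_le) fact+
      also have "?a z - \<sigma>2 / 2 = (\<Sum>s\<in>UNIV. step_var \<theta> s * (snd z s / t - q s)) / 2"
        unfolding a \<sigma>2_def by (simp add: right_diff_distrib sum_subtractf diff_divide_distrib mult.commute)
      also have "\<bar>\<dots>\<bar> \<le> (\<Sum>s\<in>UNIV. \<bar>step_var \<theta> s * (snd z s / t - q s)\<bar>)"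
        by (rule order_trans[OF _ sum_abs]) linarith
      also have "\<dots> = (\<Sum>s\<in>UNIV. step_var \<theta> s * \<bar>snd z s / t - q s\<bar>)"
        by (simp add: abs_mult step_var_nonneg)
      finally show "cmod (iexp (1 / sqrt (real t) * dev \<theta> t (fst z)) * complex_of_real (exp (?a z) - exp (\<sigma>2 / 2)))
        \<le> exp V * (\<Sum>s\<in>UNIV. step_var \<theta> s * \<bar>snd z s / t - q s\<bar>)"
        by simp
    qed
    also have "\<dots> = D t"
      by (simp add: D_def)
    finally show ?thesis .
  qed
  have "D \<longlonglongrightarrow> exp V * (\<Sum>s\<in>UNIV. step_var \<theta> s * 0)"
    unfolding D_def by (intro tendsto_mult tendsto_sum tendsto_const expectation_frequency_tendsto freq q)
  then have D: "D \<longlonglongrightarrow> 0" by simp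
  have "(\<lambda>t. ?E t (compensated \<theta> (1 / sqrt (real t)) t) - complex_of_real (exp (\<sigma>2 / 2)) * \<phi> t) \<longlonglongrightarrow> 0"
    by (rule Lim_null_comparison[OF _ D], rule eventually_sequentiallyI[of 1], rule bound)
  from tendsto_diff[OF expectation_compensated_tendsto[where \<theta> = \<theta> and \<xi> = \<xi> and ?x0.0 = x0] this]
  have "(\<lambda>t. complex_of_real (exp (\<sigma>2 / 2)) * \<phi> t) \<longlonglongrightarrow> 1"
    by simp
  from tendsto_mult_left[OF this, of "complex_of_real (exp (- \<sigma>2 / 2))"]
  have "(\<lambda>t. complex_of_real (exp (- \<sigma>2 / 2) * exp (\<sigma>2 / 2)) * \<phi> t) \<longlonglongrightarrow> complex_of_real (exp (- \<sigma>2 / 2))"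
    by (simp only: mult_1_right of_real_mult mult.assoc)
  moreover have "exp (- \<sigma>2 / 2) * exp (\<sigma>2 / 2) = 1"
    by (simp flip: exp_add)
  ultimately show ?thesis
    by (simp only: of_real_1 mult_1_left \<phi>_def \<sigma>2_def)
qed

section \<open>Tightness and weak convergence for a fixed environment\<close>

text \<open>Uniform in \<open>t\<close>: the variance term is linear in \<open>t\<close> and loses
  that factor, the starting term only shrinks for \<open>t \<ge> 1\<close>, and at
  \<open>t = 0\<close> the scale is 0.\<close>

lemma scaled_second_moment:
  "measure_pmf.expectation (counted_walk p \<xi> x0 t) (\<lambda>z. (1 / sqrt (real t) * dev \<theta> t (fst z))\<^sup>2)
    \<le> (\<theta> \<bullet> ivec x0)\<^sup>2 + (\<Sum>s\<in>UNIV. step_var \<theta> s)"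
proof (cases "t = 0")
  case True
  then show ?thesis by (simp add: sum_nonneg step_var_nonneg)
next
  case False
  have "measure_pmf.expectation (counted_walk p \<xi> x0 t) (\<lambda>z. (1 / sqrt (real t) * dev \<theta> t (fst z))\<^sup>2)
    = measure_pmf.expectation (counted_walk p \<xi> x0 t) (\<lambda>z. (dev \<theta> t (fst z))\<^sup>2) / real t"
    by (simp add: power_mult_distrib power_divide)
  also have "\<dots> \<le> ((\<theta> \<bullet> ivec x0)\<^sup>2 + real t * (\<Sum>s\<in>UNIV. step_var \<theta> s)) / real t"
    by (intro divide_right_mono dev_second_moment) simp
  also have "\<dots> = (\<theta> \<bullet> ivec x0)\<^sup>2 / real t + (\<Sum>s\<in>UNIV. step_var \<theta> s)"
    using False by (simp add: add_divide_distrib)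
  also have "(\<theta> \<bullet> ivec x0)\<^sup>2 / real t \<le> (\<theta> \<bullet> ivec x0)\<^sup>2"
    using False by (simp add: divide_le_eq mult_left_le mult_le_cancel_left1)
  finally show ?thesis by simp
qed

lemma scaled_walk_tight:
  assumes "e > 0"
  shows "\<exists>K. \<forall>t. measure_pmf.prob (counted_walk p \<xi> x0 t)
    {z. \<exists>i. \<bar>1 / sqrt (real t) * dev (axis i 1) t (fst z)\<bar> > K} \<le> e"
proof -
  define C where "C = (\<Sum>i\<in>UNIV. (axis i 1 \<bullet> ivec x0)\<^sup>2 + (\<Sum>s\<in>UNIV. step_var (axis i 1) s))"
  \<comment> \<open>Chebyshev in each direction \<open>axis i 1\<close> with a union bound requires
    \<open>C / K\<^sup>2 \<le> e\<close>; the summand 1 keeps \<open>K\<close> positive when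
    \<open>C = 0\<close>.\<close>
  define K where "K = sqrt (C / e) + 1"
  have C: "C \<ge> 0" unfolding C_def by (intro sum_nonneg add_nonneg_nonneg step_var_nonneg) auto
  have K: "K > 0" using C assms by (simp add: K_def add_nonneg_pos)
  have "C / e \<le> K\<^sup>2"
    using C assms by (simp add: K_def power2_sum)
  then have CK: "C / K\<^sup>2 \<le> e" using assms K by (simp add: field_simps)
  have "measure_pmf.prob (counted_walk p \<xi> x0 t) {z. \<exists>i. \<bar>1 / sqrt (real t) * dev (axis i 1) t (fst z)\<bar> > K} \<le> e" for t
  proof -
    let ?E = "measure_pmf.expectation (counted_walk p \<xi> x0 t)"
    let ?X = "\<lambda>i z. 1 / sqrt (real t) * dev (axis i 1) t (fst z)"
    have "measure_pmf.prob (counted_walk p \<xi> x0 t) {z. \<exists>i. \<bar>?X i z\<bar> > K}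
      = ?E (indicator {z. \<exists>i. \<bar>?X i z\<bar> > K})"
      by simp
    also have "\<dots> \<le> ?E (\<lambda>z. \<Sum>i\<in>UNIV. (?X i z)\<^sup>2 / K\<^sup>2)"
    proof (intro integral_mono integrable_walk)
      fix z
      show "indicator {z. \<exists>i. \<bar>?X i z\<bar> > K} z \<le> (\<Sum>i\<in>UNIV. (?X i z)\<^sup>2 / K\<^sup>2)"
      proof (cases "\<exists>i. \<bar>?X i z\<bar> > K")
        case True
        then obtain i where i: "\<bar>?X i z\<bar> > K" by blast
        then have "K\<^sup>2 \<le> (?X i z)\<^sup>2" using K by (intro abs_le_square_iff[THEN iffD1]) simp
        then have "1 \<le> (?X i z)\<^sup>2 / K\<^sup>2" using K by simp
        also have "\<dots> \<le> (\<Sum>i\<in>UNIV. (?X i z)\<^sup>2 / K\<^sup>2)"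
          by (rule member_le_sum[where f = "\<lambda>i. (?X i z)\<^sup>2 / K\<^sup>2"]) auto
        finally show ?thesis using True by simp
      next
        case False
        then show ?thesis by (simp add: sum_nonneg)
      qed
    qed
    also have "\<dots> = (\<Sum>i\<in>UNIV. ?E (\<lambda>z. (?X i z)\<^sup>2)) / K\<^sup>2"
      by (subst Bochner_Integration.integral_sum, rule integrable_walk)
        (simp only: integral_divide_zero sum_divide_distrib)
    also have "\<dots> \<le> C / K\<^sup>2"
      unfolding C_def by (intro divide_right_mono sum_mono scaled_second_moment) simp
    finally show ?thesis using CK by simp
  qed
  then show ?thesis by blast
qed

text \<open>Holds for each environment with convergent frequencies, so no null set arises from
  \<open>\<theta>\<close> or the test function. Only the quadratic form of \<open>S\<close> has to
  be known: symmetry moves \<open>psd_sqrt S\<close> onto \<open>\<theta>\<close>, and its square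
  gives \<open>\<theta> \<bullet> (S *v \<theta>)\<close> in the Gaussian exponent.\<close>

lemma quenched_clt:
  fixes S :: "real^'n^'n"
  assumes freq: "\<And>s \<epsilon>. \<epsilon> > 0 \<Longrightarrow>
    (\<lambda>t. measure_pmf.prob (counted_walk p \<xi> x0 t) {z. \<bar>snd z s / t - q s\<bar> \<ge> \<epsilon>}) \<longlonglongrightarrow> 0"
    and q: "\<And>s. 0 \<le> q s" "\<And>s. q s \<le> 1"
    and S: "transpose S = S" "\<And>\<theta>. \<theta> \<bullet> (S *v \<theta>) = (\<Sum>s\<in>UNIV. q s * step_var \<theta> s)"
  shows "conv_distr
    (\<lambda>t. distr (measure_pmf (map_pmf fst (counted_walk p \<xi> x0 t))) borel
            (\<lambda>x. (1 / sqrt (real t)) *\<^sub>R (ivec x - real t *\<^sub>R b)))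
    (distr std_gaussian borel (\<lambda>z. psd_sqrt S *v z))"
proof (rule conv_distr_of_characteristic_functions)
  let ?M = "\<lambda>t. distr (measure_pmf (map_pmf fst (counted_walk p \<xi> x0 t))) borel
            (\<lambda>x. (1 / sqrt (real t)) *\<^sub>R (ivec x - real t *\<^sub>R b))"
  let ?R = "psd_sqrt S"
  have psd: "0 \<le> \<theta> \<bullet> (S *v \<theta>)" for \<theta>
    unfolding S(2) by (intro sum_nonneg mult_nonneg_nonneg q step_var_nonneg)
  have R: "transpose ?R = ?R" "?R ** ?R = S"
    using psd_sqrt_properties[OF S(1) psd] by auto
  interpret G: prob_space "std_gaussian :: (real^'n) measure"
    by (rule prob_space_std_gaussian)
  have Rm: "(\<lambda>z. ?R *v z) \<in> measurable std_gaussian borel"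
    using borel_measurable_continuous_onI[OF matrix_vector_mult_linear_continuous_on, of ?R]
    by (simp cong: measurable_cong_sets)
  show "prob_space (?M t)" "sets (?M t) = sets borel" for t
    by (auto intro: measure_pmf.prob_space_distr)
  show "prob_space (distr std_gaussian borel (\<lambda>z. ?R *v z))"
    by (rule G.prob_space_distr[OF Rm])
  show "sets (distr std_gaussian borel (\<lambda>z. ?R *v z)) = sets borel" by simp
  show "(\<lambda>t. \<integral>x. iexp (\<theta> \<bullet> x) \<partial>?M t) \<longlonglongrightarrow> (\<integral>x. iexp (\<theta> \<bullet> x) \<partial>distr std_gaussian borel (\<lambda>z. ?R *v z))" for \<theta>
  proof -
    have "(\<integral>x. iexp (\<theta> \<bullet> x) \<partial>distr std_gaussian borel (\<lambda>z. ?R *v z)) = (\<integral>z. iexp (\<theta> \<bullet> (?R *v z)) \<partial>std_gaussian)"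
      by (rule integral_distr[OF Rm]) measurable
    also have "\<dots> = (\<integral>z. iexp ((?R *v \<theta>) \<bullet> z) \<partial>std_gaussian)"
      by (subst symmetric_matrix_inner[OF R(1)]) (rule refl)
    also have "\<dots> = complex_of_real (exp (- (\<theta> \<bullet> (S *v \<theta>)) / 2))"
      by (simp only: char_std_gaussian) (simp only: symmetric_matrix_inner[OF R(1)] matrix_vector_mul_assoc R(2))
    finally have "(\<integral>x. iexp (\<theta> \<bullet> x) \<partial>distr std_gaussian borel (\<lambda>z. ?R *v z))
      = complex_of_real (exp (- (\<Sum>s\<in>UNIV. q s * step_var \<theta> s) / 2))"
      by (simp only: S(2))
    moreover have "(\<integral>x. iexp (\<theta> \<bullet> x) \<partial>?M t)
      = measure_pmf.expectation (counted_walk p \<xi> x0 t) (\<lambda>z. iexp (1 / sqrt (real t) * dev \<theta> t (fst z)))" for t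
      by (subst integral_distr) (auto simp: dev_def)
    ultimately show ?thesis
      using characteristic_function_tendsto[OF freq q, of \<theta>] by (simp only:)
  qed
  show "\<exists>K. \<forall>t. measure (?M t) (- {x. \<forall>i. \<bar>x $ i\<bar> \<le> K}) \<le> e" if e: "e > 0" for e
  proof -
    obtain K where K: "\<And>t. measure_pmf.prob (counted_walk p \<xi> x0 t)
        {z. \<exists>i. \<bar>1 / sqrt (real t) * dev (axis i 1) t (fst z)\<bar> > K} \<le> e"
      using scaled_walk_tight[OF e] by blast
    have "measure (?M t) (- {x. \<forall>i. \<bar>x $ i\<bar> \<le> K}) \<le> e" for t
    proof -
      have "{x::real^'n. \<forall>i. \<bar>x $ i\<bar> \<le> K} = cbox (\<chi> i. - K) (\<chi> i. K)"
        by (auto simp: mem_box_cart abs_le_iff minus_le_iff)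
      then have "{x::real^'n. \<forall>i. \<bar>x $ i\<bar> \<le> K} \<in> sets borel" by simp
      from borel_comp[OF this] have "measure (?M t) (- {x. \<forall>i. \<bar>x $ i\<bar> \<le> K})
        = measure_pmf.prob (counted_walk p \<xi> x0 t) {z. \<exists>i. \<bar>1 / sqrt (real t) * dev (axis i 1) t (fst z)\<bar> > K}"
        by (subst measure_distr) (auto simp: vimage_def dev_def inner_axis' not_le intro!: arg_cong[where f = "measure _"])
      then show ?thesis using K[of t] by simp
    qed
    then show ?thesis by blast
  qed
qed

end

lemma finite_int_vec_box: "finite {u :: int^'n. \<forall>i. \<bar>u $ i\<bar> \<le> R}"
proof (rule finite_subset)
  show "{u :: int^'n. \<forall>i. \<bar>u $ i\<bar> \<le> R} \<subseteq> vec_lambda ` PiE UNIV (\<lambda>_. {- R..R})"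
  proof
    fix u :: "int^'n" assume "u \<in> {u. \<forall>i. \<bar>u $ i\<bar> \<le> R}"
    then have "vec_nth u \<in> PiE UNIV (\<lambda>_. {- R..R})" by (auto simp: abs_le_iff minus_le_iff)
    then show "u \<in> vec_lambda ` PiE UNIV (\<lambda>_. {- R..R})" by (intro image_eqI[where x = "vec_nth u"]) simp
  qed
qed (intro finite_imageI finite_PiE; simp)

subsection \<open>The quenched central limit theorem\<close>

theorem theorem2p1:
  fixes mu :: "'s::finite pmf"
    and P0 :: "(int^'n) pmf"
    and c :: "int^'n \<Rightarrow> 's \<Rightarrow> real"
    and bc :: "real^'n"
    and x0 :: "int^'n"
  assumes range01: "\<And>u s. 0 \<le> pmf P0 u + c u s \<and> pmf P0 u + c u s \<le> 1"
    and sum_c: "\<And>s. (\<Sum>\<^sub>\<infinity>u. c u s) = 0"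
    and mean_c: "\<And>u. (\<Sum>s\<in>UNIV. c u s * pmf mu s) = 0"
    and bounded_range: "\<exists>R::int. \<forall>u. (\<exists>i. \<bar>u $ i\<bar> > R) \<longrightarrow> pmf P0 u = 0 \<and> (\<forall>s. c u s = 0)"
    and drift_c: "\<And>s. (\<Sum>\<^sub>\<infinity>u. c u s *\<^sub>R ivec u) = bc"
  shows "let b0 = (\<Sum>\<^sub>\<infinity>u. pmf P0 u *\<^sub>R ivec u);
             b = b0 + bc;
             Pbar = (\<lambda>u. pmf P0 u + (\<Sum>s\<in>UNIV. pmf mu s * c u s));
             eta2 = (\<chi> i j. \<Sum>\<^sub>\<infinity>u. (ivec u $ i - b $ i) * (ivec u $ j - b $ j) * Pbar u)
         in AE xi in env_law mu.
              conv_distr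
                (\<lambda>t. distr (measure_pmf (quenched_law P0 c xi x0 t)) borel
                        (\<lambda>x. (1 / sqrt (real t)) *\<^sub>R (ivec x - real t *\<^sub>R b)))
                (distr std_gaussian borel (\<lambda>z. psd_sqrt eta2 *v z))"
proof -
  obtain R :: int where R: "\<And>u. \<exists>i. \<bar>u $ i\<bar> > R \<Longrightarrow> pmf P0 u = 0 \<and> (\<forall>s. c u s = 0)"
    using bounded_range by blast
  define B where "B = {u :: int^'n. \<forall>i. \<bar>u $ i\<bar> \<le> R}"
  have B: "finite B" unfolding B_def by (rule finite_int_vec_box)
  have P0B: "pmf P0 u = 0" and cB: "c u s = 0" if "u \<notin> B" for u s
    using R[of u] that by (auto simp: B_def not_le)
  \<comment> \<open>Polymorphic in the values, because it serves the real sums of \<open>c\<close>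
    and \<open>eta2\<close> as well as the vector-valued drifts.\<close>
  have infsum_B: "(\<Sum>\<^sub>\<infinity>u. f u) = sum f B" if "\<And>u. u \<notin> B \<Longrightarrow> f u = 0" for f :: "int^'n \<Rightarrow> 'c::{topological_comm_monoid_add, t2_space}"
    using infsum_cong_neutral[of B UNIV f f] that B by (simp add: infsum_finite)
  define p where "p = step_pmf P0 c"
  \<comment> \<open>\<open>embed_pmf\<close> returns the intended weights only if they are
    nonnegative with total mass 1, which is what \<open>range01\<close> and \<open>sum_c\<close>
    supply.\<close>
  have pmf_p: "pmf (p s) u = pmf P0 u + c u s" for s u
  proof -
    have "(\<integral>\<^sup>+u. ennreal (pmf P0 u + c u s) \<partial>count_space UNIV) = (\<Sum>u\<in>B. ennreal (pmf P0 u + c u s))"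
      using B by (intro nn_integral_count_space'[OF B]) (auto simp: P0B cB)
    also have "\<dots> = ennreal ((\<Sum>u\<in>B. pmf P0 u) + (\<Sum>u\<in>B. c u s))"
      using range01 by (subst sum_ennreal) (auto simp: sum.distrib)
    also have "(\<Sum>u\<in>B. pmf P0 u) = 1"
      using P0B by (intro sum_pmf_eq_1[OF B]) (auto simp: set_pmf_eq)
    also have "(\<Sum>u\<in>B. c u s) = 0"
      using infsum_B[of "\<lambda>u. c u s"] sum_c[of s] cB by simp
    finally show ?thesis
      unfolding p_def step_pmf_def using range01 by (subst pmf_embed_pmf) auto
  qed
  have set_p: "set_pmf (p s) \<subseteq> B" for s
    using P0B cB by (fastforce simp: set_pmf_eq pmf_p)
  define b where "b = (\<Sum>\<^sub>\<infinity>u. pmf P0 u *\<^sub>R ivec u) + bc"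
  have Ep: "measure_pmf.expectation (p s) f = (\<Sum>u\<in>B. (pmf P0 u + c u s) *\<^sub>R f u)"
    for s and f :: "int^'n \<Rightarrow> 'c::{banach, second_countable_topology}"
    using set_p by (subst integral_measure_pmf[OF B]) (auto simp: pmf_p)
  interpret finite_range_steps p b
  proof
    fix s
    show "finite (set_pmf (p s))" using set_p B by (rule finite_subset)
    have "(\<Sum>u\<in>B. c u s *\<^sub>R ivec u) = bc"
      using drift_c[of s] by (subst (asm) infsum_B) (auto simp: cB)
    moreover have "(\<Sum>\<^sub>\<infinity>u. pmf P0 u *\<^sub>R ivec u) = (\<Sum>u\<in>B. pmf P0 u *\<^sub>R ivec u :: real^'n)"
      by (rule infsum_B) (simp add: P0B)
    ultimately show "measure_pmf.expectation (p s) ivec = b"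
      unfolding Ep b_def by (simp add: scaleR_add_left sum.distrib)
  qed
  define Pbar where "Pbar u = pmf P0 u + (\<Sum>s\<in>UNIV. pmf mu s * c u s)" for u
  define eta2 :: "real^'n^'n"
    where "eta2 = (\<chi> i j. \<Sum>\<^sub>\<infinity>u. (ivec u $ i - b $ i) * (ivec u $ j - b $ j) * Pbar u)"
  have eta2_B: "eta2 $ i $ j = (\<Sum>u\<in>B. (ivec u $ i - b $ i) * (ivec u $ j - b $ j) * Pbar u)" for i j
    unfolding eta2_def by (simp, rule infsum_B) (simp add: Pbar_def P0B cB)
  have sym: "transpose eta2 = eta2"
    by (simp add: vec_eq_iff transpose_def eta2_B mult_ac)
  have mu1: "(\<Sum>s\<in>UNIV. pmf mu s) = 1"
    by (intro sum_pmf_eq_1) auto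
  \<comment> \<open>\<open>Pbar\<close> is the mixture of the step laws under \<open>mu\<close>. All
    of them have mean \<open>b\<close>, so its covariance is the average of theirs, with no
    contribution from fluctuating means.\<close>
  have Pbar_avg: "Pbar u = (\<Sum>s\<in>UNIV. pmf mu s * (pmf P0 u + c u s))" for u
    by (simp add: Pbar_def distrib_left sum.distrib mu1 flip: sum_distrib_right)
  have quad: "\<theta> \<bullet> (eta2 *v \<theta>) = (\<Sum>s\<in>UNIV. pmf mu s * step_var \<theta> s)" for \<theta>
  proof -
    let ?w = "\<lambda>u. ivec u - b"
    have "\<theta> \<bullet> (eta2 *v \<theta>) = (\<Sum>i\<in>UNIV. \<Sum>j\<in>UNIV. \<Sum>u\<in>B. Pbar u * ((\<theta> $ i * ?w u $ i) * (\<theta> $ j * ?w u $ j)))"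
      by (simp add: inner_vec_def matrix_vector_mult_def eta2_B sum_distrib_left sum_distrib_right mult_ac)
    also have "\<dots> = (\<Sum>i\<in>UNIV. \<Sum>u\<in>B. \<Sum>j\<in>UNIV. Pbar u * ((\<theta> $ i * ?w u $ i) * (\<theta> $ j * ?w u $ j)))"
      by (intro sum.cong refl sum.swap)
    also have "\<dots> = (\<Sum>u\<in>B. \<Sum>i\<in>UNIV. \<Sum>j\<in>UNIV. Pbar u * ((\<theta> $ i * ?w u $ i) * (\<theta> $ j * ?w u $ j)))"
      by (rule sum.swap)
    also have "\<dots> = (\<Sum>u\<in>B. Pbar u * (\<theta> \<bullet> ?w u)\<^sup>2)"
      by (simp only: power2_eq_square inner_vec_def sum_product inner_real_def) (simp only: sum_distrib_left)
    also have "\<dots> = (\<Sum>u\<in>B. \<Sum>s\<in>UNIV. pmf mu s * ((pmf P0 u + c u s) * (\<theta> \<bullet> ?w u)\<^sup>2))"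
      unfolding Pbar_avg by (simp only: sum_distrib_right mult.assoc)
    also have "\<dots> = (\<Sum>s\<in>UNIV. \<Sum>u\<in>B. pmf mu s * ((pmf P0 u + c u s) * (\<theta> \<bullet> ?w u)\<^sup>2))"
      by (rule sum.swap)
    finally show ?thesis
      by (simp only: step_var_def Ep sum_distrib_left real_scaleR_def)
  qed
  \<comment> \<open>Finitely many states and the thresholds \<open>1 / real (Suc k)\<close> give
    countably many null sets; monotonicity in the threshold then covers every positive
    \<open>\<epsilon>\<close>.\<close>
  have "AE \<xi> in env_law mu. \<forall>s k. (\<lambda>t. measure_pmf.prob (counted_walk p \<xi> x0 t)
      {z. \<bar>snd z s / t - pmf mu s\<bar> \<ge> 1 / real (Suc k)}) \<longlonglongrightarrow> 0"
    unfolding AE_all_countable by (intro allI count_frequency_tendsto) simp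
  then have "AE xi in env_law mu. conv_distr
                (\<lambda>t. distr (measure_pmf (quenched_law P0 c xi x0 t)) borel
                        (\<lambda>x. (1 / sqrt (real t)) *\<^sub>R (ivec x - real t *\<^sub>R b)))
                (distr std_gaussian borel (\<lambda>z. psd_sqrt eta2 *v z))"
  proof eventually_elim
    case (elim \<xi>)
    have "(\<lambda>t. measure_pmf.prob (counted_walk p \<xi> x0 t) {z. \<bar>snd z s / t - pmf mu s\<bar> \<ge> \<epsilon>}) \<longlonglongrightarrow> 0"
      if \<epsilon>: "\<epsilon> > 0" for s \<epsilon>
    proof -
      obtain k where k: "1 / real (Suc k) < \<epsilon>"
        using nat_approx_posE[OF \<epsilon>] by metis
      show ?thesis
      proof (rule tendsto_sandwich[OF _ _ tendsto_const elim[rule_format]])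
        show "\<forall>\<^sub>F t in sequentially. measure_pmf.prob (counted_walk p \<xi> x0 t) {z. \<bar>snd z s / t - pmf mu s\<bar> \<ge> \<epsilon>}
          \<le> measure_pmf.prob (counted_walk p \<xi> x0 t) {z. \<bar>snd z s / t - pmf mu s\<bar> \<ge> 1 / real (Suc k)}"
          using k by (intro always_eventually allI measure_pmf.finite_measure_mono) auto
      qed simp
    qed
    from quenched_clt[OF this _ _ sym quad] show ?case
      unfolding quenched_law_eq_map_counted_walk p_def[symmetric] by (simp add: pmf_le_1)
  qed
  then show ?thesis
    unfolding Let_def b_def eta2_def Pbar_def .
qed

end
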